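(* A group $H$ of (finite) order $n$ is IYB if and only if its corresponding elementary crossed product grading class $\left[\left(\sum_{h\in H}h\right)(\mathbb{C})\right]$ is a quotient of some twisted group algebra grading class of $M_n(\mathbb{C})$.
   Context: A finite group $H$ is IYB (involutive Yang–Baxter) if it admits an $H$-module $M$ (an abelian group with an action of $H$ by automorphisms) and a bijective 1-cocycle $\delta\in Z^1(H,M)$. A $\Gamma$-grading of a complex algebra $\mathcal{A}$ is a decomposition $\mathcal{A}=\bigoplus_{\gamma\in\Gamma}\mathcal{A}_\gamma$ with $\mathcal{A}_{\gamma_1}\mathcal{A}_{\gamma_2}\subseteq\mathcal{A}_{\gamma_1\gamma_2}$. A quotient morphism from a $\Gamma_1$-grading $\mathcal{G}_1$ of $\mathcal{A}$ to a $\Gamma_2$-grading $\mathcal{G}_2$ of $\mathcal{B}$ is a pair $(\psi,\phi)$ of an algebra isomorphism $\psi:\mathcal{A}\to\mathcal{B}$ and a surjective group homomorphism $\phi:\Gamma_1\to\Gamma_2$ with $\psi(\mathcal{A}_\gamma)\subseteq\mathcal{B}_{\phi(\gamma)}$ for all $\gamma$; it is a graded-equivalence if $\phi$ is an isomorphism. $[\cdot]$ denotes the graded-equivalence class; $[\mathcal{G}_2]$ is a quotient of $[\mathcal{G}_1]$ if there is a quotient morphism $\mathcal{G}_1\to\mathcal{G}_2$. For a finite group $G$ and $\alpha\in Z^2(G,\mathbb{C}^* )$ (trivial action), $\mathbb{C}^{\alpha}G=\bigoplus_{g\in G}\mathbb{C}u_g$, $u_gu_h=\alpha(g,h)u_{gh}$,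 is graded by $G$ via $(\mathbb{C}^{\alpha}G)_g=\mathbb{C}u_g$. A twisted group algebra grading class of $M_n(\mathbb{C})$ is a class $[\mathbb{C}^{\alpha}G]$ with $\mathbb{C}^{\alpha}G\cong M_n(\mathbb{C})$ as algebras. For a finite group $H=\{h_1,\dots,h_n\}$ of order $n$, the elementary crossed product grading $\left(\sum_{h\in H}h\right)(\mathbb{C})$ is the $H$-grading of $M_n(\mathbb{C})$ in which the matrix unit $E_{i,j}$ has degree $h_ih_j^{-1}$. *)

theory Defs
  imports "HOL-Algebra.QuotRing" "HOL-Algebra.Module" "HOL-Algebra.Bij" "Jordan_Normal_Form.Matrix"
begin

text \<open>
  The module \<^term>\<open>M\<close> is written multiplicatively, and the action is a homomorphism into the
  automorphism group. Since \<^term>\<open>\<delta>\<close> is a bijection and \<^term>\<open>H\<close> is finite, \<^term>\<open>M\<close> is finite,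
  so letting its elements be natural numbers is no restriction; see lemma \<open>IYB_I\<close>.
\<close>

definition bijective_cocycle ::
    "'a monoid \<Rightarrow> 'm monoid \<Rightarrow> ('a \<Rightarrow> 'm \<Rightarrow> 'm) \<Rightarrow> ('a \<Rightarrow> 'm) \<Rightarrow> bool" where
  "bijective_cocycle H M act \<delta> \<longleftrightarrow>
     comm_group M \<and> act \<in> hom H (AutoGroup M) \<and> bij_betw \<delta> (carrier H) (carrier M) \<and>
     (\<forall>g\<in>carrier H. \<forall>h\<in>carrier H. \<delta> (g \<otimes>\<^bsub>H\<^esub> h) = \<delta> g \<otimes>\<^bsub>M\<^esub> act g (\<delta> h))"

definition IYB :: "'a monoid \<Rightarrow> bool" where
  "IYB H \<longleftrightarrow> group H \<and> finite (carrier H) \<and>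
     (\<exists>(M :: nat monoid) act \<delta>. bijective_cocycle H M act \<delta>)"

abbreviation complex_ring :: "complex ring" where
  "complex_ring \<equiv> \<lparr>carrier = UNIV, monoid.mult = (*), one = 1, zero = 0, add = (+)\<rparr>"

text \<open>The library locale \<open>algebra\<close> cannot be used: it covers commutative algebras only.\<close>

locale complex_algebra = module complex_ring A + ring A for A :: "(complex, 'm) module" (structure) +
  assumes smult_mult_left:
      "\<lbrakk>x \<in> carrier A; y \<in> carrier A\<rbrakk> \<Longrightarrow> (c \<odot> x) \<otimes> y = c \<odot> (x \<otimes> y)"
    and smult_mult_right:
      "\<lbrakk>x \<in> carrier A; y \<in> carrier A\<rbrakk> \<Longrightarrow> x \<otimes> (c \<odot> y) = c \<odot> (x \<otimes> y)"

definition algebra_iso ::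
    "(complex, 'm) module \<Rightarrow> (complex, 'k) module \<Rightarrow> ('m \<Rightarrow> 'k) set" where
  "algebra_iso A B =
     {\<psi> \<in> ring_iso A B. \<forall>c. \<forall>x\<in>carrier A. \<psi> (c \<odot>\<^bsub>A\<^esub> x) = c \<odot>\<^bsub>B\<^esub> \<psi> x}"

record ('g, 'm) grading =
  alg :: "(complex, 'm) module"
  grp :: "'g monoid"
  cmp :: "'g \<Rightarrow> 'm set"

text \<open>
  The axiom \<open>direct_sum\<close> says that every element is a sum of finitely many homogeneous
  elements in exactly one way; the values of \<^term>\<open>f\<close> off the group are normalised to zero.
\<close>

locale graded_algebra =
  fixes \<G> :: "('g, 'm) grading"
  assumes complex_algebra: "complex_algebra (alg \<G>)"
    and group: "group (grp \<G>)"
    and submodule: "\<gamma> \<in> carrier (grp \<G>) \<Longrightarrow> submodule (cmp \<G> \<gamma>) complex_ring (alg \<G>)"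
    and direct_sum: "x \<in> carrier (alg \<G>) \<Longrightarrow>
      \<exists>!f. (\<forall>\<gamma>\<in>carrier (grp \<G>). f \<gamma> \<in> cmp \<G> \<gamma>) \<and>
           (\<forall>\<gamma>. \<gamma> \<notin> carrier (grp \<G>) \<longrightarrow> f \<gamma> = \<zero>\<^bsub>alg \<G>\<^esub>) \<and>
           finite {\<gamma>. f \<gamma> \<noteq> \<zero>\<^bsub>alg \<G>\<^esub>} \<and>
           x = finsum (alg \<G>) f {\<gamma>. f \<gamma> \<noteq> \<zero>\<^bsub>alg \<G>\<^esub>}"
    and cmp_mult:
      "\<lbrakk>\<gamma> \<in> carrier (grp \<G>); \<gamma>' \<in> carrier (grp \<G>); x \<in> cmp \<G> \<gamma>; y \<in> cmp \<G> \<gamma>'\<rbrakk>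
       \<Longrightarrow> x \<otimes>\<^bsub>alg \<G>\<^esub> y \<in> cmp \<G> (\<gamma> \<otimes>\<^bsub>grp \<G>\<^esub> \<gamma>')"

definition quotient_morphism ::
    "('g, 'm) grading \<Rightarrow> ('h, 'k) grading \<Rightarrow> ('m \<Rightarrow> 'k) \<Rightarrow> ('g \<Rightarrow> 'h) \<Rightarrow> bool" where
  "quotient_morphism \<G>\<^sub>1 \<G>\<^sub>2 \<psi> \<phi> \<longleftrightarrow>
     \<psi> \<in> algebra_iso (alg \<G>\<^sub>1) (alg \<G>\<^sub>2) \<and> \<phi> \<in> epi (grp \<G>\<^sub>1) (grp \<G>\<^sub>2) \<and>
     (\<forall>\<gamma>\<in>carrier (grp \<G>\<^sub>1). \<psi> ` cmp \<G>\<^sub>1 \<gamma> \<subseteq> cmp \<G>\<^sub>2 (\<phi> \<gamma>))"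

definition graded_equivalent :: "('g, 'm) grading \<Rightarrow> ('h, 'k) grading \<Rightarrow> bool" where
  "graded_equivalent \<G>\<^sub>1 \<G>\<^sub>2 \<longleftrightarrow>
     (\<exists>\<psi> \<phi>. quotient_morphism \<G>\<^sub>1 \<G>\<^sub>2 \<psi> \<phi> \<and> \<phi> \<in> iso (grp \<G>\<^sub>1) (grp \<G>\<^sub>2))"

text \<open>A class consists of the equivalent gradings on the same types as the representative.\<close>

definition grading_class :: "('g, 'm) grading \<Rightarrow> ('g, 'm) grading set" where
  "grading_class \<G> = {\<G>'. graded_algebra \<G>' \<and> graded_equivalent \<G> \<G>'}"

definition is_quotient_class :: "('h, 'k) grading set \<Rightarrow> ('g, 'm) grading set \<Rightarrow> bool" where
  "is_quotient_class C\<^sub>2 C\<^sub>1 \<longleftrightarrow>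
     (\<exists>\<G>\<^sub>1\<in>C\<^sub>1. \<exists>\<G>\<^sub>2\<in>C\<^sub>2. \<exists>\<psi> \<phi>. quotient_morphism \<G>\<^sub>1 \<G>\<^sub>2 \<psi> \<phi>)"

definition two_cocycle :: "'g monoid \<Rightarrow> ('g \<Rightarrow> 'g \<Rightarrow> complex) \<Rightarrow> bool" where
  "two_cocycle G \<alpha> \<longleftrightarrow>
     (\<forall>g\<in>carrier G. \<forall>h\<in>carrier G. \<alpha> g h \<noteq> 0) \<and>
     (\<forall>g\<in>carrier G. \<forall>h\<in>carrier G. \<forall>k\<in>carrier G.
        \<alpha> g h * \<alpha> (g \<otimes>\<^bsub>G\<^esub> h) k = \<alpha> h k * \<alpha> g (h \<otimes>\<^bsub>G\<^esub> k))"

text \<open>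
  An element of the twisted group algebra is the function of its coefficients in the basis
  \<open>u\<^sub>g\<close>. Cocycles are not assumed to be normalised, so the unit is
  \<open>\<alpha>(1,1)\<^sup>-\<^sup>1 u\<^sub>1\<close>.
\<close>

definition twisted_group_algebra ::
    "'g monoid \<Rightarrow> ('g \<Rightarrow> 'g \<Rightarrow> complex) \<Rightarrow> (complex, 'g \<Rightarrow> complex) module" where
  "twisted_group_algebra G \<alpha> =
     \<lparr>carrier = {x. \<forall>g. g \<notin> carrier G \<longrightarrow> x g = 0},
      monoid.mult = (\<lambda>x y k. \<Sum>g\<in>carrier G. \<Sum>h\<in>carrier G.
                if g \<otimes>\<^bsub>G\<^esub> h = k then x g * y h * \<alpha> g h else 0),
      one = (\<lambda>k. if k = \<one>\<^bsub>G\<^esub> then inverse (\<alpha> \<one>\<^bsub>G\<^esub> \<one>\<^bsub>G\<^esub>) else 0),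
      zero = (\<lambda>k. 0),
      add = (\<lambda>x y k. x k + y k),
      smult = (\<lambda>c x k. c * x k)\<rparr>"

definition twisted_grading ::
    "'g monoid \<Rightarrow> ('g \<Rightarrow> 'g \<Rightarrow> complex) \<Rightarrow> ('g, 'g \<Rightarrow> complex) grading" where
  "twisted_grading G \<alpha> =
     \<lparr>alg = twisted_group_algebra G \<alpha>, grp = G, cmp = (\<lambda>g. {x. \<forall>k. k \<noteq> g \<longrightarrow> x k = 0})\<rparr>"

abbreviation matrix_algebra :: "nat \<Rightarrow> (complex, complex mat) module" where
  "matrix_algebra n \<equiv> module_mat TYPE(complex) n n"

text \<open>
  Every finite group is isomorphic to one whose elements are natural numbers, so taking
  \<^term>\<open>G\<close> of that form loses no class; see lemma \<open>twisted_grading_on_nat\<close>.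
\<close>

definition twisted_group_algebra_classes :: "nat \<Rightarrow> (nat, nat \<Rightarrow> complex) grading set set" where
  "twisted_group_algebra_classes n =
     {grading_class (twisted_grading G \<alpha>) | G \<alpha>.
        group G \<and> finite (carrier G) \<and> two_cocycle G \<alpha> \<and>
        algebra_iso (twisted_group_algebra G \<alpha>) (matrix_algebra n) \<noteq> {}}"

text \<open>
  The component of degree \<open>\<gamma>\<close> is the span of the matrix units \<open>E\<^sub>i\<^sub>j\<close> of degree
  \<open>h\<^sub>i h\<^sub>j\<^sup>-\<^sup>1 = \<gamma>\<close>. The enumeration \<^term>\<open>h\<close> starts at 0.
\<close>

definition elementary_crossed_product ::
    "'a monoid \<Rightarrow> nat \<Rightarrow> (nat \<Rightarrow> 'a) \<Rightarrow> ('a, complex mat) grading" where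
  "elementary_crossed_product H n h =
     \<lparr>alg = matrix_algebra n, grp = H,
      cmp = (\<lambda>\<gamma>. {X \<in> carrier_mat n n.
               \<forall>i<n. \<forall>j<n. X $$ (i, j) \<noteq> 0 \<longrightarrow> h i \<otimes>\<^bsub>H\<^esub> inv\<^bsub>H\<^esub> (h j) = \<gamma>})\<rparr>"

subsection \<open>Basic facts justifying the definitions\<close>

text \<open>
  The main facts are \<open>IYB_I\<close> and \<open>twisted_grading_on_nat\<close> (carriers in the natural numbers
  suffice), \<open>graded_algebra_twisted\<close> and \<open>graded_algebra_elementary\<close> (both constructions are
  gradings), and \<open>is_quotient_class_iff\<close> (being a quotient does not depend on representatives).
\<close>

lemma hom_AutoGroup_iff:
  "act \<in> hom H (AutoGroup M) \<longleftrightarrow> (\<forall>g\<in>carrier H. act g \<in> auto M) \<and>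
     (\<forall>g\<in>carrier H. \<forall>h\<in>carrier H. act (g \<otimes>\<^bsub>H\<^esub> h) = compose (carrier M) (act g) (act h))"
  unfolding hom_def AutoGroup_def BijGroup_def auto_def by (auto simp: Pi_iff)

lemma finite_group_nat_copy:
  fixes G :: "'g monoid"
  assumes "group G" and fin: "finite (carrier G)"
  obtains G' :: "nat monoid" and e where "group G'" "e \<in> iso G G'"
proof -
  interpret G: group G by fact
  obtain e :: "'g \<Rightarrow> nat" where e: "inj_on e (carrier G)"
    using fin finite_imp_inj_to_nat_seg by blast
  define f where "f = inv_into (carrier G) e"
  have fe: "\<And>x. x \<in> carrier G \<Longrightarrow> f (e x) = x" using e by (simp add: f_def)
  define G' where "G' = \<lparr>carrier = e ` carrier G,
    monoid.mult = (\<lambda>x y. e (f x \<otimes>\<^bsub>G\<^esub> f y)), one = e \<one>\<^bsub>G\<^esub>\<rparr>"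
  have iso: "e \<in> iso G G'"
    using e by (auto simp: iso_def hom_def G'_def fe bij_betw_def)
  moreover have "monoid G'"
    by (rule monoidI) (auto simp: G'_def fe G.m_assoc)
  ultimately have "group G'" using G.iso_imp_group unfolding is_iso_def by blast
  then show thesis using iso by (rule that)
qed

lemma IYB_I:
  fixes H :: "'a monoid" and M :: "'m monoid"
  assumes H: "group H" and fin: "finite (carrier H)" and bc: "bijective_cocycle H M act \<delta>"
  shows "IYB H"
proof -
  have bij: "bij_betw \<delta> (carrier H) (carrier M)" and M: "comm_group M"
    and act: "act \<in> hom H (AutoGroup M)"
    and coc: "\<And>g h. g \<in> carrier H \<Longrightarrow> h \<in> carrier H \<Longrightarrow>
      \<delta> (g \<otimes>\<^bsub>H\<^esub> h) = \<delta> g \<otimes>\<^bsub>M\<^esub> act g (\<delta> h)"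
    using bc unfolding bijective_cocycle_def by blast+
  interpret M: comm_group M by (rule M)
  have "finite (carrier M)" using bij fin bij_betw_finite by blast
  then obtain M' :: "nat monoid" and e where M': "group M'"
    and isoM: "e \<in> iso M M'"
    using finite_group_nat_copy[OF M.is_group] by blast
  define f where "f = inv_into (carrier M) e"
  have fe: "\<And>x. x \<in> carrier M \<Longrightarrow> f (e x) = x"
    using isoM by (simp add: f_def iso_def bij_betw_def inv_into_f_f)
  have cM': "carrier M' = e ` carrier M" using isoM by (simp add: iso_def bij_betw_def)
  have mM': "\<And>x y. x \<in> carrier M \<Longrightarrow> y \<in> carrier M \<Longrightarrow> e x \<otimes>\<^bsub>M'\<^esub> e y = e (x \<otimes>\<^bsub>M\<^esub> y)"
    using isoM by (simp add: iso_def hom_def)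
  interpret M': group M' by (rule M')
  have "comm_group M'"
    by (rule M'.group_comm_groupI) (auto simp: cM' mM' M.m_comm)
  define act' where "act' g = (\<lambda>x\<in>carrier M'. e (act g (f x)))" for g
  have a1: "act g \<in> hom M M" "act g \<in> Bij (carrier M)" if "g \<in> carrier H" for g
    using act that by (auto simp: hom_AutoGroup_iff auto_def)
  have acl: "act g x \<in> carrier M" if "g \<in> carrier H" "x \<in> carrier M" for g x
    using a1(1)[OF that(1)] that(2) by (auto simp: hom_def)
  have ae: "act' g (e x) = e (act g x)" if "x \<in> carrier M" for g x
    using that by (simp add: act'_def cM' fe)
  have b: "bij_betw (act' g) (carrier M') (carrier M')" if g: "g \<in> carrier H" for g
  proof -
    have be: "bij_betw e (carrier M) (carrier M')" using isoM by (simp add: iso_def)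
    have bf: "bij_betw f (carrier M') (carrier M)"
      by (rule bij_betw_byWitness[where f' = e]) (auto simp: cM' fe)
    have "bij_betw (act g) (carrier M) (carrier M)" using a1(2)[OF g] by (simp add: Bij_def)
    from bij_betw_trans[OF bij_betw_trans[OF bf this] be]
    have "bij_betw (e \<circ> (act g \<circ> f)) (carrier M') (carrier M')" .
    moreover have "bij_betw (e \<circ> (act g \<circ> f)) (carrier M') (carrier M') =
        bij_betw (act' g) (carrier M') (carrier M')"
      by (rule bij_betw_cong) (simp add: act'_def)
    ultimately show ?thesis by simp
  qed
  have "act' \<in> hom H (AutoGroup M')"
    unfolding hom_AutoGroup_iff
  proof (intro conjI ballI)
    fix g assume g: "g \<in> carrier H"
    have "act' g \<in> hom M' M'"
      using a1(1)[OF g] acl[OF g] by (auto simp: hom_def cM' ae mM')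
    moreover have "act' g \<in> extensional (carrier M')" by (simp add: act'_def)
    ultimately show "act' g \<in> auto M'" using b[OF g] by (simp add: auto_def Bij_def)
  next
    fix g h assume g: "g \<in> carrier H" and h: "h \<in> carrier H"
    have gh: "act (g \<otimes>\<^bsub>H\<^esub> h) = compose (carrier M) (act g) (act h)"
      using act g h by (simp add: hom_AutoGroup_iff)
    show "act' (g \<otimes>\<^bsub>H\<^esub> h) = compose (carrier M') (act' g) (act' h)"
    proof
      fix y show "act' (g \<otimes>\<^bsub>H\<^esub> h) y = compose (carrier M') (act' g) (act' h) y"
      proof (cases "y \<in> carrier M'")
        case True
        then obtain x where x: "x \<in> carrier M" "y = e x" by (auto simp: cM')
        show ?thesis using x True by (simp add: ae gh compose_def acl h)
      next
        case False
        then show ?thesis by (simp add: act'_def compose_def)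
      qed
    qed
  qed
  moreover have "bij_betw (e \<circ> \<delta>) (carrier H) (carrier M')"
    using bij_betw_trans[OF bij, of e "carrier M'"] isoM by (simp add: iso_def)
  moreover have "(e \<circ> \<delta>) (g \<otimes>\<^bsub>H\<^esub> h) = (e \<circ> \<delta>) g \<otimes>\<^bsub>M'\<^esub> act' g ((e \<circ> \<delta>) h)"
    if "g \<in> carrier H" "h \<in> carrier H" for g h
  proof -
    have "\<delta> g \<in> carrier M" "\<delta> h \<in> carrier M" using bij that by (auto simp: bij_betw_def)
    then show ?thesis using that by (simp add: coc ae mM' acl)
  qed
  ultimately have "bijective_cocycle H M' act' (e \<circ> \<delta>)"
    using \<open>comm_group M'\<close> by (simp add: bijective_cocycle_def)
  then show ?thesis using H fin by (auto simp: IYB_def)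
qed

lemma twisted_grading_on_nat:
  fixes G :: "'g monoid"
  assumes G: "group G" and fin: "finite (carrier G)" and \<alpha>: "two_cocycle G \<alpha>"
  obtains G' :: "nat monoid" and \<alpha>' where
    "group G'" "finite (carrier G')" "two_cocycle G' \<alpha>'"
    "graded_equivalent (twisted_grading G \<alpha>) (twisted_grading G' \<alpha>')"
proof -
  interpret G: group G by (rule G)
  obtain G' :: "nat monoid" and e where grp: "group G'"
    and isoG: "e \<in> iso G G'"
    using finite_group_nat_copy[OF G fin] by blast
  define f where "f = inv_into (carrier G) e"
  have fe: "\<And>x. x \<in> carrier G \<Longrightarrow> f (e x) = x"
    using isoG by (simp add: f_def iso_def bij_betw_def inv_into_f_f)
  define \<alpha>' where "\<alpha>' = (\<lambda>x y. \<alpha> (f x) (f y))"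
  define \<psi> where "\<psi> = (\<lambda>(x::'g \<Rightarrow> complex) k. if k \<in> carrier G' then x (f k) else 0)"
  have e: "inj_on e (carrier G)" and c: "carrier G' = e ` carrier G"
    using isoG by (simp_all add: iso_def bij_betw_def)
  have m: "\<And>x y. x \<in> carrier G \<Longrightarrow> y \<in> carrier G \<Longrightarrow> e x \<otimes>\<^bsub>G'\<^esub> e y = e (x \<otimes>\<^bsub>G\<^esub> y)"
    using isoG by (simp add: iso_def hom_def)
  have o: "\<one>\<^bsub>G'\<^esub> = e \<one>\<^bsub>G\<^esub>"
    using isoG hom_one[OF _ G grp, of e] by (simp add: iso_def)
  have eq: "\<And>x y. x \<in> carrier G \<Longrightarrow> y \<in> carrier G \<Longrightarrow> e x = e y \<longleftrightarrow> x = y"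
    using e by (auto simp: inj_on_def)
  have coc: "two_cocycle G' \<alpha>'"
    using \<alpha> unfolding two_cocycle_def c \<alpha>'_def by (auto simp: fe m)
  have sume: "sum F (carrier G') = (\<Sum>g\<in>carrier G. F (e g))" for F :: "nat \<Rightarrow> complex"
    unfolding c using e by (simp add: sum.reindex)
  have \<psi>e: "\<psi> x (e g) = x g" if "g \<in> carrier G" for x g
    using that by (simp add: \<psi>_def c fe)
  let ?A = "twisted_group_algebra G \<alpha>" and ?B = "twisted_group_algebra G' \<alpha>'"
  have ext: "\<psi> x = y" if "\<And>k. k \<notin> carrier G' \<Longrightarrow> y k = 0" "\<And>g. g \<in> carrier G \<Longrightarrow> x g = y (e g)" for x y
  proof
    fix k show "\<psi> x k = y k"
      using that(1)[of k] that(2)[of "f k"] by (cases "k \<in> carrier G'") (auto simp: \<psi>_def c fe)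
  qed
  have \<psi>mult: "\<psi> (x \<otimes>\<^bsub>?A\<^esub> y) = \<psi> x \<otimes>\<^bsub>?B\<^esub> \<psi> y" for x y
  proof (rule ext)
    fix k assume "k \<notin> carrier G'"
    then have "\<And>g h. g \<in> carrier G' \<Longrightarrow> h \<in> carrier G' \<Longrightarrow> g \<otimes>\<^bsub>G'\<^esub> h \<noteq> k"
      using grp by (metis group.is_monoid monoid.m_closed)
    then show "(\<psi> x \<otimes>\<^bsub>?B\<^esub> \<psi> y) k = 0"
      by (simp add: twisted_group_algebra_def)
  next
    fix k assume "k \<in> carrier G"
    then show "(x \<otimes>\<^bsub>?A\<^esub> y) k = (\<psi> x \<otimes>\<^bsub>?B\<^esub> \<psi> y) (e k)"
      by (auto simp: twisted_group_algebra_def sume \<psi>e m eq \<alpha>'_def fe intro!: sum.cong)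
  qed
  have bij: "bij_betw \<psi> (carrier ?A) (carrier ?B)"
  proof (rule bij_betw_byWitness[where f' = "\<lambda>y g. if g \<in> carrier G then y (e g) else 0"])
    show "\<forall>x\<in>carrier ?A. (\<lambda>g. if g \<in> carrier G then \<psi> x (e g) else 0) = x"
      by (auto simp: twisted_group_algebra_def \<psi>e fun_eq_iff)
    show "\<forall>y\<in>carrier ?B. \<psi> (\<lambda>g. if g \<in> carrier G then y (e g) else 0) = y"
      by (auto simp: twisted_group_algebra_def \<psi>_def c fe fun_eq_iff)
  qed (auto simp: twisted_group_algebra_def \<psi>_def)
  have "\<psi> \<one>\<^bsub>?A\<^esub> = \<one>\<^bsub>?B\<^esub>"
    by (rule ext) (auto simp: twisted_group_algebra_def c o eq \<alpha>'_def fe)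
  then have "\<psi> \<in> ring_iso ?A ?B"
    using bij \<psi>mult unfolding ring_iso_def Ring.ring_hom_def
    by (auto simp: bij_betw_def) (auto simp: twisted_group_algebra_def \<psi>_def fun_eq_iff)
  then have "\<psi> \<in> algebra_iso ?A ?B"
    by (auto simp: algebra_iso_def) (auto simp: twisted_group_algebra_def \<psi>_def fun_eq_iff)
  moreover have "e \<in> epi G G'" using isoG by (simp add: iso_iff_mon_epi)
  moreover have "\<psi> ` cmp (twisted_grading G \<alpha>) g \<subseteq> cmp (twisted_grading G' \<alpha>') (e g)"
    if "g \<in> carrier G" for g
  proof
    fix y assume "y \<in> \<psi> ` cmp (twisted_grading G \<alpha>) g"
    then obtain x where x: "y = \<psi> x" "\<And>k. k \<noteq> g \<Longrightarrow> x k = 0" by (auto simp: twisted_grading_def)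
    have "y k = 0" if "k \<noteq> e g" for k
    proof (cases "k \<in> carrier G'")
      case True
      then have "f k \<noteq> g" using that fe by (auto simp: c)
      then show ?thesis using x True by (simp add: \<psi>_def)
    qed (simp add: x \<psi>_def)
    then show "y \<in> cmp (twisted_grading G' \<alpha>') (e g)" by (simp add: twisted_grading_def)
  qed
  ultimately have "quotient_morphism (twisted_grading G \<alpha>) (twisted_grading G' \<alpha>') \<psi> e"
    by (auto simp: quotient_morphism_def twisted_grading_def)
  then have "graded_equivalent (twisted_grading G \<alpha>) (twisted_grading G' \<alpha>')"
    using isoG by (auto simp: graded_equivalent_def twisted_grading_def)
  moreover have "finite (carrier G')" using fin by (simp add: c)
  ultimately show thesis using that[OF grp _ coc] by blast
qed

lemma algebra_iso_trans:
  assumes "\<psi> \<in> algebra_iso A B" and "\<psi>' \<in> algebra_iso B C"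
  shows "\<psi>' \<circ> \<psi> \<in> algebra_iso A C"
  using assms ring_iso_set_trans[of \<psi> A B \<psi>' C]
  by (auto simp: algebra_iso_def ring_iso_memE(1))

lemma quotient_morphism_trans:
  assumes "quotient_morphism \<G>\<^sub>1 \<G>\<^sub>2 \<psi> \<phi>" and "quotient_morphism \<G>\<^sub>2 \<G>\<^sub>3 \<psi>' \<phi>'"
  shows "quotient_morphism \<G>\<^sub>1 \<G>\<^sub>3 (\<psi>' \<circ> \<psi>) (\<phi>' \<circ> \<phi>)"
proof -
  have "\<phi> \<gamma> \<in> carrier (grp \<G>\<^sub>2)" if "\<gamma> \<in> carrier (grp \<G>\<^sub>1)" for \<gamma>
    using assms(1) that by (auto simp: quotient_morphism_def epi_def)
  then show ?thesis
    using assms unfolding quotient_morphism_def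
    by (auto intro!: algebra_iso_trans epi_compose) (meson image_subset_iff)
qed

lemma algebra_iso_sym:
  assumes A: "complex_algebra A" and \<psi>: "\<psi> \<in> algebra_iso A B"
  shows "inv_into (carrier A) \<psi> \<in> algebra_iso B A"
proof -
  interpret A: complex_algebra A by (rule A)
  have r: "\<psi> \<in> ring_iso A B" and s: "\<And>c x. x \<in> carrier A \<Longrightarrow> \<psi> (c \<odot>\<^bsub>A\<^esub> x) = c \<odot>\<^bsub>B\<^esub> \<psi> x"
    using \<psi> by (auto simp: algebra_iso_def)
  have bij: "bij_betw \<psi> (carrier A) (carrier B)" using r by (rule ring_iso_memE(5))
  have "inv_into (carrier A) \<psi> (c \<odot>\<^bsub>B\<^esub> y) = c \<odot>\<^bsub>A\<^esub> inv_into (carrier A) \<psi> y" if "y \<in> carrier B" for c y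
  proof -
    obtain x where x: "x \<in> carrier A" "y = \<psi> x" using bij \<open>y \<in> carrier B\<close> by (auto simp: bij_betw_def)
    have "c \<odot>\<^bsub>B\<^esub> y = \<psi> (c \<odot>\<^bsub>A\<^esub> x)" using s x by simp
    moreover have "c \<odot>\<^bsub>A\<^esub> x \<in> carrier A" using x by simp
    ultimately show ?thesis using x bij by (simp add: bij_betw_def inv_into_f_f)
  qed
  then show ?thesis using ring_iso_set_sym[OF A.ring_axioms r] by (simp add: algebra_iso_def)
qed

lemma finsum_ring_hom:
  assumes "ring R" and "ring S" and "h \<in> Ring.ring_hom R S"
    and "finite T" and f: "\<And>t. f t \<in> carrier R"
  shows "finsum S (h \<circ> f) T = h (finsum R f T)"
proof -
  interpret R: ring R by fact
  interpret S: ring S by fact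
  interpret h: RingHom.ring_hom_ring R S h by (rule ring_hom_ringI2) fact+
  show ?thesis using \<open>finite T\<close>
  proof (induction rule: finite_induct)
    case empty
    show ?case by simp
  next
    case (insert t T)
    have "finsum S (h \<circ> f) (insert t T) = h (f t) \<oplus>\<^bsub>S\<^esub> finsum S (h \<circ> f) T"
      using insert.hyps f by (subst S.finsum_insert) auto
    also have "\<dots> = h (f t \<oplus>\<^bsub>R\<^esub> finsum R f T)"
      unfolding insert.IH using f by (intro h.hom_add[symmetric] R.finsum_closed) auto
    also have "f t \<oplus>\<^bsub>R\<^esub> finsum R f T = finsum R f (insert t T)"
      using insert.hyps f by (subst R.finsum_insert) auto
    finally show ?case .
  qed
qed

lemma graded_equivalent_sym:
  assumes G1: "graded_algebra \<G>\<^sub>1" and G2: "graded_algebra \<G>\<^sub>2"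
    and eq: "graded_equivalent \<G>\<^sub>1 \<G>\<^sub>2"
  shows "graded_equivalent \<G>\<^sub>2 \<G>\<^sub>1"
proof -
  interpret G1: graded_algebra \<G>\<^sub>1 by (rule G1)
  interpret G2: graded_algebra \<G>\<^sub>2 by (rule G2)
  interpret A: complex_algebra "alg \<G>\<^sub>1" by (rule G1.complex_algebra)
  interpret B: complex_algebra "alg \<G>\<^sub>2" by (rule G2.complex_algebra)
  let ?A = "alg \<G>\<^sub>1" and ?B = "alg \<G>\<^sub>2" and ?\<Gamma> = "grp \<G>\<^sub>1" and ?\<Delta> = "grp \<G>\<^sub>2"
  obtain \<psi> \<phi> where q: "quotient_morphism \<G>\<^sub>1 \<G>\<^sub>2 \<psi> \<phi>" and iso: "\<phi> \<in> iso ?\<Gamma> ?\<Delta>"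
    using eq by (auto simp: graded_equivalent_def)
  have \<psi>: "\<psi> \<in> algebra_iso ?A ?B"
    and sub: "\<And>\<gamma> x. \<gamma> \<in> carrier ?\<Gamma> \<Longrightarrow> x \<in> cmp \<G>\<^sub>1 \<gamma> \<Longrightarrow> \<psi> x \<in> cmp \<G>\<^sub>2 (\<phi> \<gamma>)"
    using q by (auto simp: quotient_morphism_def)
  have r: "\<psi> \<in> ring_iso ?A ?B" using \<psi> by (simp add: algebra_iso_def)
  have bij: "bij_betw \<psi> (carrier ?A) (carrier ?B)" using r by (rule ring_iso_memE(5))
  have hom: "\<psi> \<in> Ring.ring_hom ?A ?B" using r by (simp add: ring_iso_def)
  interpret h: ring_hom_ring ?A ?B \<psi>
    by (rule ring_hom_ringI2[OF A.ring_axioms B.ring_axioms hom])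
  have bijg: "bij_betw \<phi> (carrier ?\<Gamma>) (carrier ?\<Delta>)" using iso by (simp add: iso_def)
  define \<phi>' where "\<phi>' = inv_into (carrier ?\<Gamma>) \<phi>"
  define \<psi>' where "\<psi>' = inv_into (carrier ?A) \<psi>"
  have iso': "\<phi>' \<in> iso ?\<Delta> ?\<Gamma>" unfolding \<phi>'_def by (rule group.iso_set_sym[OF G1.group iso])
  have \<psi>': "\<psi>' \<in> algebra_iso ?B ?A"
    unfolding \<psi>'_def by (rule algebra_iso_sym[OF G1.complex_algebra \<psi>])
  have \<phi>'c: "\<phi>' \<delta> \<in> carrier ?\<Gamma>" and \<phi>\<phi>': "\<phi> (\<phi>' \<delta>) = \<delta>" if "\<delta> \<in> carrier ?\<Delta>" for \<delta>
    using that bijg by (auto simp: \<phi>'_def bij_betw_def inv_into_into f_inv_into_f)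
  have \<phi>'\<phi>: "\<phi>' (\<phi> \<gamma>) = \<gamma>" "\<phi> \<gamma> \<in> carrier ?\<Delta>" if "\<gamma> \<in> carrier ?\<Gamma>" for \<gamma>
    using that bijg by (auto simp: \<phi>'_def bij_betw_def inv_into_f_f)
  have sub2: "cmp \<G>\<^sub>2 \<delta> \<subseteq> carrier ?B" "\<zero>\<^bsub>?B\<^esub> \<in> cmp \<G>\<^sub>2 \<delta>" if "\<delta> \<in> carrier ?\<Delta>" for \<delta>
    using subgroup.subset[OF submodule.axioms(1)[OF G2.submodule[OF that]]]
      subgroup.one_closed[OF submodule.axioms(1)[OF G2.submodule[OF that]]] by simp_all
  have sub1: "cmp \<G>\<^sub>1 \<delta> \<subseteq> carrier ?A" "\<zero>\<^bsub>?A\<^esub> \<in> cmp \<G>\<^sub>1 \<delta>" if "\<delta> \<in> carrier ?\<Gamma>" for \<delta>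
    using subgroup.subset[OF submodule.axioms(1)[OF G1.submodule[OF that]]]
      subgroup.one_closed[OF submodule.axioms(1)[OF G1.submodule[OF that]]] by simp_all
  have "\<psi>' y \<in> cmp \<G>\<^sub>1 (\<phi>' \<delta>)" if \<delta>: "\<delta> \<in> carrier ?\<Delta>" and y: "y \<in> cmp \<G>\<^sub>2 \<delta>" for \<delta> y
  proof -
    have yc: "y \<in> carrier ?B" using sub2(1)[OF \<delta>] y by blast
    obtain x where x: "x \<in> carrier ?A" "y = \<psi> x" using bij yc by (auto simp: bij_betw_def)
    have \<psi>'y: "\<psi>' y = x" using x bij by (simp add: \<psi>'_def bij_betw_def inv_into_f_f)
    obtain f where f: "\<forall>\<gamma>\<in>carrier ?\<Gamma>. f \<gamma> \<in> cmp \<G>\<^sub>1 \<gamma>"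
      and f0: "\<forall>\<gamma>. \<gamma> \<notin> carrier ?\<Gamma> \<longrightarrow> f \<gamma> = \<zero>\<^bsub>?A\<^esub>"
      and ffin: "finite {\<gamma>. f \<gamma> \<noteq> \<zero>\<^bsub>?A\<^esub>}" and fsum: "x = finsum ?A f {\<gamma>. f \<gamma> \<noteq> \<zero>\<^bsub>?A\<^esub>}"
      using G1.direct_sum[OF x(1)] by metis
    let ?S = "{\<gamma>. f \<gamma> \<noteq> \<zero>\<^bsub>?A\<^esub>}"
    have SG: "?S \<subseteq> carrier ?\<Gamma>" using f0 by auto
    have fc: "f \<gamma> \<in> carrier ?A" for \<gamma>
      using f f0 sub1(1) by (cases "\<gamma> \<in> carrier ?\<Gamma>") auto
    have hom_finsum: "finsum ?B (\<psi> \<circ> f) T = \<psi> (finsum ?A f T)" if "finite T" for T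
      by (rule finsum_ring_hom[OF A.ring_axioms B.ring_axioms hom that fc])
    have inj: "u = v" if "u \<in> carrier ?A" "v \<in> carrier ?A" "\<psi> u = \<psi> v" for u v
      using bij that by (auto simp: bij_betw_def inj_on_def)
    define g where "g \<epsilon> = (if \<epsilon> \<in> carrier ?\<Delta> then \<psi> (f (\<phi>' \<epsilon>)) else \<zero>\<^bsub>?B\<^esub>)" for \<epsilon>
    define g' where "g' \<epsilon> = (if \<epsilon> = \<delta> then y else \<zero>\<^bsub>?B\<^esub>)" for \<epsilon>
    have z: "\<psi> u = \<zero>\<^bsub>?B\<^esub> \<longleftrightarrow> u = \<zero>\<^bsub>?A\<^esub>" if "u \<in> carrier ?A" for u
      using inj[OF that A.zero_closed] h.hom_zero by auto
    have gS: "{\<epsilon>. g \<epsilon> \<noteq> \<zero>\<^bsub>?B\<^esub>} = \<phi> ` ?S"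
    proof (intro equalityI subsetI)
      fix \<epsilon> assume "\<epsilon> \<in> {\<epsilon>. g \<epsilon> \<noteq> \<zero>\<^bsub>?B\<^esub>}"
      then have "\<epsilon> \<in> carrier ?\<Delta>" "f (\<phi>' \<epsilon>) \<noteq> \<zero>\<^bsub>?A\<^esub>" by (auto simp: g_def z fc split: if_splits)
      then show "\<epsilon> \<in> \<phi> ` ?S" using \<phi>\<phi>' by (metis (mono_tags, lifting) image_eqI mem_Collect_eq)
    next
      fix \<epsilon> assume "\<epsilon> \<in> \<phi> ` ?S"
      then show "\<epsilon> \<in> {\<epsilon>. g \<epsilon> \<noteq> \<zero>\<^bsub>?B\<^esub>}" using SG by (auto simp: g_def z fc \<phi>'\<phi> subset_iff)
    qed
    have "inj_on \<phi> ?S" using bijg SG by (auto simp: bij_betw_def intro: inj_on_subset)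
    then have "finsum ?B g (\<phi> ` ?S) = finsum ?B (\<lambda>\<gamma>. g (\<phi> \<gamma>)) ?S"
      using fc by (intro B.finsum_reindex) (auto simp: g_def)
    also have "\<dots> = finsum ?B (\<psi> \<circ> f) ?S"
      using SG fc by (intro B.finsum_cong') (auto simp: g_def \<phi>'\<phi> subset_iff)
    also have "\<dots> = \<psi> (finsum ?A f ?S)"
      by (rule hom_finsum[OF ffin])
    also have "\<dots> = y" using fsum x(2) by simp
    finally have "y = finsum ?B g {\<epsilon>. g \<epsilon> \<noteq> \<zero>\<^bsub>?B\<^esub>}" by (simp add: gS)
    moreover have "\<forall>\<epsilon>\<in>carrier ?\<Delta>. g \<epsilon> \<in> cmp \<G>\<^sub>2 \<epsilon>"
      using sub[OF \<phi>'c] f \<phi>'c \<phi>\<phi>' by (metis g_def)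
    ultimately have G: "(\<forall>\<epsilon>\<in>carrier ?\<Delta>. g \<epsilon> \<in> cmp \<G>\<^sub>2 \<epsilon>) \<and> (\<forall>\<epsilon>. \<epsilon> \<notin> carrier ?\<Delta> \<longrightarrow> g \<epsilon> = \<zero>\<^bsub>?B\<^esub>) \<and>
        finite {\<epsilon>. g \<epsilon> \<noteq> \<zero>\<^bsub>?B\<^esub>} \<and> y = finsum ?B g {\<epsilon>. g \<epsilon> \<noteq> \<zero>\<^bsub>?B\<^esub>}"
      using ffin by (simp add: gS) (simp add: g_def)
    have S': "{\<epsilon>. g' \<epsilon> \<noteq> \<zero>\<^bsub>?B\<^esub>} = (if y = \<zero>\<^bsub>?B\<^esub> then {} else {\<delta>})" by (auto simp: g'_def)
    have "y = finsum ?B g' {\<epsilon>. g' \<epsilon> \<noteq> \<zero>\<^bsub>?B\<^esub>}"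
      using yc by (simp add: S' B.finsum_insert) (simp add: g'_def)
    then have G': "(\<forall>\<epsilon>\<in>carrier ?\<Delta>. g' \<epsilon> \<in> cmp \<G>\<^sub>2 \<epsilon>) \<and> (\<forall>\<epsilon>. \<epsilon> \<notin> carrier ?\<Delta> \<longrightarrow> g' \<epsilon> = \<zero>\<^bsub>?B\<^esub>) \<and>
        finite {\<epsilon>. g' \<epsilon> \<noteq> \<zero>\<^bsub>?B\<^esub>} \<and> y = finsum ?B g' {\<epsilon>. g' \<epsilon> \<noteq> \<zero>\<^bsub>?B\<^esub>}"
      using y \<delta> sub2(2) by (auto simp: S') (auto simp: g'_def)
    have "g = g'" using ex1_implies_ex G2.direct_sum[OF yc] G G' by blast
    then have "\<psi> (f (\<phi>' \<delta>)) = y" using \<delta> by (metis g_def g'_def)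
    then have "f (\<phi>' \<delta>) = x" using x inj fc by blast
    then show ?thesis using \<psi>'y f \<phi>'c[OF \<delta>] by force
  qed
  then have "quotient_morphism \<G>\<^sub>2 \<G>\<^sub>1 \<psi>' \<phi>'"
    using \<psi>' iso' by (auto simp: quotient_morphism_def iso_iff_mon_epi)
  then show ?thesis using iso' by (auto simp: graded_equivalent_def)
qed

lemma graded_equivalent_refl: "graded_equivalent \<G> \<G>"
proof -
  have "quotient_morphism \<G> \<G> id id"
    by (auto simp: quotient_morphism_def algebra_iso_def ring_iso_def Ring.ring_hom_def epi_def hom_def)
  moreover have "id \<in> iso (grp \<G>) (grp \<G>)" by (auto simp: iso_def hom_def)
  ultimately show ?thesis by (auto simp: graded_equivalent_def)
qed

lemma is_quotient_class_iff:
  fixes \<G>\<^sub>1 :: "('g, 'm) grading" and \<G>\<^sub>2 :: "('h, 'k) grading"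
  assumes "graded_algebra \<G>\<^sub>1" and "graded_algebra \<G>\<^sub>2"
  shows "is_quotient_class (grading_class \<G>\<^sub>2) (grading_class \<G>\<^sub>1) \<longleftrightarrow>
    (\<exists>\<psi> \<phi>. quotient_morphism \<G>\<^sub>1 \<G>\<^sub>2 \<psi> \<phi>)"
proof
  assume "is_quotient_class (grading_class \<G>\<^sub>2) (grading_class \<G>\<^sub>1)"
  then obtain X :: "('g, 'm) grading" and Y :: "('h, 'k) grading" and \<psi> \<phi>
    where X: "X \<in> grading_class \<G>\<^sub>1" and Y: "Y \<in> grading_class \<G>\<^sub>2" and XY: "quotient_morphism X Y \<psi> \<phi>"
    unfolding is_quotient_class_def by (elim bexE exE)
  obtain \<psi>\<^sub>1 \<phi>\<^sub>1 where 1: "quotient_morphism \<G>\<^sub>1 X \<psi>\<^sub>1 \<phi>\<^sub>1"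
    using X by (auto simp: grading_class_def graded_equivalent_def)
  have "graded_equivalent Y \<G>\<^sub>2"
    using Y graded_equivalent_sym[OF assms(2), of Y] by (simp add: grading_class_def)
  then obtain \<psi>\<^sub>2 \<phi>\<^sub>2 where 2: "quotient_morphism Y \<G>\<^sub>2 \<psi>\<^sub>2 \<phi>\<^sub>2"
    by (auto simp: graded_equivalent_def)
  show "\<exists>\<psi> \<phi>. quotient_morphism \<G>\<^sub>1 \<G>\<^sub>2 \<psi> \<phi>"
    using quotient_morphism_trans[OF quotient_morphism_trans[OF 1 XY] 2] by blast
next
  assume "\<exists>\<psi> \<phi>. quotient_morphism \<G>\<^sub>1 \<G>\<^sub>2 \<psi> \<phi>"
  moreover have "\<G>\<^sub>1 \<in> grading_class \<G>\<^sub>1" "\<G>\<^sub>2 \<in> grading_class \<G>\<^sub>2"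
    using assms graded_equivalent_refl by (auto simp: grading_class_def)
  ultimately show "is_quotient_class (grading_class \<G>\<^sub>2) (grading_class \<G>\<^sub>1)"
    unfolding is_quotient_class_def by (elim bexI[rotated])
qed

lemma graded_algebraI:
  assumes A: "complex_algebra (alg \<G>)" and g: "group (grp \<G>)"
    and fin: "finite (carrier (grp \<G>))"
    and sub: "\<And>\<gamma>. \<gamma> \<in> carrier (grp \<G>) \<Longrightarrow> submodule (cmp \<G> \<gamma>) complex_ring (alg \<G>)"
    and mult: "\<And>\<gamma> \<gamma>' x y. \<lbrakk>\<gamma> \<in> carrier (grp \<G>); \<gamma>' \<in> carrier (grp \<G>); x \<in> cmp \<G> \<gamma>; y \<in> cmp \<G> \<gamma>'\<rbrakk>
       \<Longrightarrow> x \<otimes>\<^bsub>alg \<G>\<^esub> y \<in> cmp \<G> (\<gamma> \<otimes>\<^bsub>grp \<G>\<^esub> \<gamma>')"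
    and ex: "\<And>x. x \<in> carrier (alg \<G>) \<Longrightarrow> \<exists>f. (\<forall>\<gamma>\<in>carrier (grp \<G>). f \<gamma> \<in> cmp \<G> \<gamma>) \<and>
        x = finsum (alg \<G>) f (carrier (grp \<G>))"
    and uniq: "\<And>f f' \<gamma>. \<lbrakk>\<And>\<gamma>. \<gamma> \<in> carrier (grp \<G>) \<Longrightarrow> f \<gamma> \<in> cmp \<G> \<gamma>;
        \<And>\<gamma>. \<gamma> \<in> carrier (grp \<G>) \<Longrightarrow> f' \<gamma> \<in> cmp \<G> \<gamma>;
        finsum (alg \<G>) f (carrier (grp \<G>)) = finsum (alg \<G>) f' (carrier (grp \<G>));
        \<gamma> \<in> carrier (grp \<G>)\<rbrakk> \<Longrightarrow> f \<gamma> = f' \<gamma>"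
  shows "graded_algebra \<G>"
proof (rule graded_algebra.intro[OF A g sub _ mult])
  interpret complex_algebra "alg \<G>" by (rule A)
  let ?A = "alg \<G>" and ?C = "carrier (grp \<G>)"
  have subc: "cmp \<G> \<gamma> \<subseteq> carrier ?A" if "\<gamma> \<in> ?C" for \<gamma>
    using subgroup.subset[OF submodule.axioms(1)[OF sub[OF that]]] by simp
  have supp: "finsum ?A f {\<gamma>. f \<gamma> \<noteq> \<zero>\<^bsub>?A\<^esub>} = finsum ?A f ?C"
    if "\<forall>\<gamma>\<in>?C. f \<gamma> \<in> cmp \<G> \<gamma>" "\<forall>\<gamma>. \<gamma> \<notin> ?C \<longrightarrow> f \<gamma> = \<zero>\<^bsub>?A\<^esub>" for f
    using that subc by (intro add.finprod_mono_neutral_cong_left[OF fin]) auto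
  fix x assume "x \<in> carrier ?A"
  then obtain f where f: "\<forall>\<gamma>\<in>?C. f \<gamma> \<in> cmp \<G> \<gamma>" "x = finsum ?A f ?C" using ex by blast
  define f' where "f' \<gamma> = (if \<gamma> \<in> ?C then f \<gamma> else \<zero>\<^bsub>?A\<^esub>)" for \<gamma>
  have f': "\<forall>\<gamma>\<in>?C. f' \<gamma> \<in> cmp \<G> \<gamma>" "\<forall>\<gamma>. \<gamma> \<notin> ?C \<longrightarrow> f' \<gamma> = \<zero>\<^bsub>?A\<^esub>"
    using f by (auto simp: f'_def)
  have "x = finsum ?A f' ?C"
    unfolding f(2) using f' subc by (intro finsum_cong') (auto simp: f'_def Pi_iff subset_iff)
  moreover have "finite {\<gamma>. f' \<gamma> \<noteq> \<zero>\<^bsub>?A\<^esub>}"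
    by (rule finite_subset[OF _ fin]) (auto simp: f'_def)
  ultimately have P: "(\<forall>\<gamma>\<in>?C. f' \<gamma> \<in> cmp \<G> \<gamma>) \<and> (\<forall>\<gamma>. \<gamma> \<notin> ?C \<longrightarrow> f' \<gamma> = \<zero>\<^bsub>?A\<^esub>) \<and>
      finite {\<gamma>. f' \<gamma> \<noteq> \<zero>\<^bsub>?A\<^esub>} \<and> x = finsum ?A f' {\<gamma>. f' \<gamma> \<noteq> \<zero>\<^bsub>?A\<^esub>}"
    using f' by (simp add: supp[OF f'])
  have U: "f'' = f'" if f'': "\<forall>\<gamma>\<in>?C. f'' \<gamma> \<in> cmp \<G> \<gamma>" "\<forall>\<gamma>. \<gamma> \<notin> ?C \<longrightarrow> f'' \<gamma> = \<zero>\<^bsub>?A\<^esub>"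
    and x: "x = finsum ?A f'' {\<gamma>. f'' \<gamma> \<noteq> \<zero>\<^bsub>?A\<^esub>}" for f''
  proof
    fix \<gamma>
    have "finsum ?A f'' ?C = finsum ?A f' ?C"
      using x \<open>x = finsum ?A f' ?C\<close> supp[OF f''] by simp
    then show "f'' \<gamma> = f' \<gamma>"
      using uniq[of f'' f' \<gamma>] f''(1,2) f' by (cases "\<gamma> \<in> ?C") auto
  qed
  show "\<exists>!f. (\<forall>\<gamma>\<in>?C. f \<gamma> \<in> cmp \<G> \<gamma>) \<and> (\<forall>\<gamma>. \<gamma> \<notin> ?C \<longrightarrow> f \<gamma> = \<zero>\<^bsub>?A\<^esub>) \<and>
      finite {\<gamma>. f \<gamma> \<noteq> \<zero>\<^bsub>?A\<^esub>} \<and> x = finsum ?A f {\<gamma>. f \<gamma> \<noteq> \<zero>\<^bsub>?A\<^esub>}"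
    by (rule ex1I, rule P, elim conjE, rule U)
qed

lemma complex_ring_cring: "cring complex_ring"
proof (rule cringI)
  show "abelian_group complex_ring"
  proof (rule abelian_groupI)
    fix x show "\<exists>y\<in>carrier complex_ring. y \<oplus>\<^bsub>complex_ring\<^esub> x = \<zero>\<^bsub>complex_ring\<^esub>"
      by (rule bexI[of _ "- x"]) simp_all
  qed (simp_all add: add_ac)
  show "comm_monoid complex_ring"
    by (rule comm_monoidI) auto
qed (auto simp: ring_distribs)

lemma complex_algebra_matrix: "complex_algebra (matrix_algebra n)"
proof -
  interpret ring "matrix_algebra n"
    using ring_mat[where 'a = complex, of n "\<lparr>smult = (\<cdot>\<^sub>m)\<rparr>"]
    by (simp add: ring_mat_def module_mat_def)
  have "module complex_ring (matrix_algebra n)"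
    by (rule moduleI[OF complex_ring_cring abelian_group_axioms])
      (auto simp: module_mat_def add_smult_distrib_right_mat add_smult_distrib_left_mat)
  then show ?thesis
    by (intro complex_algebra.intro complex_algebra_axioms.intro ring_axioms)
      (auto simp: module_mat_def mult_smult_distrib)
qed

lemma finsum_matrix:
  assumes "finite S" and "\<And>s. s \<in> S \<Longrightarrow> f s \<in> carrier_mat n n"
  shows "finsum (matrix_algebra n) f S = mat n n (\<lambda>(i, j). \<Sum>s\<in>S. f s $$ (i, j))"
proof -
  interpret complex_algebra "matrix_algebra n" by (rule complex_algebra_matrix)
  show ?thesis using assms
  proof (induction rule: finite_induct)
    case (insert s S)
    have "f s \<in> carrier_mat n n" using insert by simp
    with insert show ?case
      by (simp add: finsum_insert Pi_iff module_mat_simps) (auto simp: module_mat_def intro!: eq_matI)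
  qed (auto simp: module_mat_simps)
qed

lemma graded_algebra_elementary:
  assumes H: "group H" and fin: "finite (carrier H)" and h: "h ` {..<n} \<subseteq> carrier H"
  shows "graded_algebra (elementary_crossed_product H n h)"
proof -
  interpret H: group H by (rule H)
  interpret A: complex_algebra "matrix_algebra n" by (rule complex_algebra_matrix)
  let ?G = "elementary_crossed_product H n h"
  have s: "alg ?G = matrix_algebra n" "grp ?G = H"
    by (simp_all add: elementary_crossed_product_def)
  have hc: "h i \<in> carrier H" if "i < n" for i using h that by auto
  have in_cmp: "X \<in> cmp ?G \<gamma> \<longleftrightarrow> X \<in> carrier_mat n n \<and>
      (\<forall>i<n. \<forall>j<n. X $$ (i, j) \<noteq> 0 \<longrightarrow> h i \<otimes>\<^bsub>H\<^esub> inv\<^bsub>H\<^esub> (h j) = \<gamma>)" for X \<gamma>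
    by (simp add: elementary_crossed_product_def)
  show ?thesis
  proof (rule graded_algebraI, unfold s)
    fix \<gamma>
    show "submodule (cmp ?G \<gamma>) complex_ring (matrix_algebra n)"
    proof (rule A.submoduleI)
      fix X assume X: "X \<in> cmp ?G \<gamma>"
      then have Xc: "X \<in> carrier (matrix_algebra n)" by (simp add: in_cmp module_mat_def)
      have "\<ominus>\<^bsub>matrix_algebra n\<^esub> X = - X"
        by (rule A.minus_equality) (use Xc in \<open>auto simp: module_mat_def\<close>)
      then show "\<ominus>\<^bsub>matrix_algebra n\<^esub> X \<in> cmp ?G \<gamma>" using X by (auto simp: in_cmp)
    next
      fix X Y assume "X \<in> cmp ?G \<gamma>" "Y \<in> cmp ?G \<gamma>"
      then show "X \<oplus>\<^bsub>matrix_algebra n\<^esub> Y \<in> cmp ?G \<gamma>"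
        by (auto simp: in_cmp module_mat_def) (metis add_0)
    qed (auto simp: in_cmp module_mat_def)
  next
    fix \<gamma> \<gamma>' X Y assume g: "\<gamma> \<in> carrier H" "\<gamma>' \<in> carrier H" and X: "X \<in> cmp ?G \<gamma>" and Y: "Y \<in> cmp ?G \<gamma>'"
    have "h i \<otimes>\<^bsub>H\<^esub> inv\<^bsub>H\<^esub> (h j) = \<gamma> \<otimes>\<^bsub>H\<^esub> \<gamma>'" if i: "i < n" and j: "j < n" and nz: "(X * Y) $$ (i, j) \<noteq> 0" for i j
    proof -
      have "(X * Y) $$ (i, j) = (\<Sum>k<n. X $$ (i, k) * Y $$ (k, j))"
        using X Y i j by (auto simp: in_cmp scalar_prod_def atLeast0LessThan)
      then obtain k where k: "k < n" "X $$ (i, k) \<noteq> 0" "Y $$ (k, j) \<noteq> 0"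
        using nz by (metis (no_types, lifting) lessThan_iff mult_eq_0_iff sum.neutral)
      then have "\<gamma> \<otimes>\<^bsub>H\<^esub> \<gamma>' = (h i \<otimes>\<^bsub>H\<^esub> inv\<^bsub>H\<^esub> (h k)) \<otimes>\<^bsub>H\<^esub> (h k \<otimes>\<^bsub>H\<^esub> inv\<^bsub>H\<^esub> (h j))"
        using X Y i j by (simp add: in_cmp)
      then show ?thesis using hc i j k by (simp add: H.m_assoc H.inv_solve_left flip: H.m_assoc) (simp add: H.m_assoc)
    qed
    then show "X \<otimes>\<^bsub>matrix_algebra n\<^esub> Y \<in> cmp ?G (\<gamma> \<otimes>\<^bsub>H\<^esub> \<gamma>')"
      using X Y by (auto simp: in_cmp module_mat_def)
  next
    fix X assume "X \<in> carrier (matrix_algebra n)"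
    then have X: "X \<in> carrier_mat n n" by (simp add: module_mat_def)
    define f where "f \<gamma> = mat n n (\<lambda>(i, j). if h i \<otimes>\<^bsub>H\<^esub> inv\<^bsub>H\<^esub> (h j) = \<gamma> then X $$ (i, j) else 0)" for \<gamma>
    have "finsum (matrix_algebra n) f (carrier H) = mat n n (\<lambda>(i, j). \<Sum>\<gamma>\<in>carrier H. f \<gamma> $$ (i, j))"
      by (rule finsum_matrix[OF fin]) (simp add: f_def)
    also have "\<dots> = X"
      using X fin hc by (intro eq_matI) (auto simp: f_def)
    finally show "\<exists>f. (\<forall>\<gamma>\<in>carrier H. f \<gamma> \<in> cmp ?G \<gamma>) \<and> X = finsum (matrix_algebra n) f (carrier H)"
      by (intro exI[of _ f]) (auto simp: in_cmp f_def split: if_splits)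
  next
    fix f f' \<gamma>
    assume f: "\<And>\<gamma>. \<gamma> \<in> carrier H \<Longrightarrow> f \<gamma> \<in> cmp ?G \<gamma>" and f': "\<And>\<gamma>. \<gamma> \<in> carrier H \<Longrightarrow> f' \<gamma> \<in> cmp ?G \<gamma>"
      and eq: "finsum (matrix_algebra n) f (carrier H) = finsum (matrix_algebra n) f' (carrier H)"
      and \<gamma>: "\<gamma> \<in> carrier H"
    have *: "finsum (matrix_algebra n) F (carrier H) $$ (i, j) = F (h i \<otimes>\<^bsub>H\<^esub> inv\<^bsub>H\<^esub> (h j)) $$ (i, j)"
      if F: "\<And>\<gamma>. \<gamma> \<in> carrier H \<Longrightarrow> F \<gamma> \<in> cmp ?G \<gamma>" and ij: "i < n" "j < n" for F i j
    proof -
      have "finsum (matrix_algebra n) F (carrier H) $$ (i, j) = (\<Sum>\<gamma>\<in>carrier H. F \<gamma> $$ (i, j))"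
        using F ij by (subst finsum_matrix[OF fin]) (auto simp: in_cmp)
      also have "\<dots> = (\<Sum>\<gamma>\<in>carrier H. if \<gamma> = h i \<otimes>\<^bsub>H\<^esub> inv\<^bsub>H\<^esub> (h j) then F \<gamma> $$ (i, j) else 0)"
        using F ij by (intro sum.cong) (auto simp: in_cmp)
      finally show ?thesis using fin hc ij by simp
    qed
    show "f \<gamma> = f' \<gamma>"
    proof (rule eq_matI)
      fix i j assume "i < dim_row (f' \<gamma>)" "j < dim_col (f' \<gamma>)"
      then have ij: "i < n" "j < n" using f'[OF \<gamma>] by (auto simp: in_cmp)
      show "f \<gamma> $$ (i, j) = f' \<gamma> $$ (i, j)"
      proof (cases "h i \<otimes>\<^bsub>H\<^esub> inv\<^bsub>H\<^esub> (h j) = \<gamma>")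
        case True
        then show ?thesis using *[OF f ij] *[OF f' ij] eq by simp
      next
        case False
        then show ?thesis using f[OF \<gamma>] f'[OF \<gamma>] ij by (simp add: in_cmp) metis
      qed
    qed (use f[OF \<gamma>] f'[OF \<gamma>] in \<open>auto simp: in_cmp\<close>)
  qed (use H fin complex_algebra_matrix in auto)
qed

lemma complex_algebra_twisted:
  assumes G: "group G" and fin: "finite (carrier G)" and \<alpha>: "two_cocycle G \<alpha>"
  shows "complex_algebra (twisted_group_algebra G \<alpha>)"
proof -
  interpret G: group G by (rule G)
  let ?A = "twisted_group_algebra G \<alpha>"
  have nz: "\<alpha> g h \<noteq> 0" if "g \<in> carrier G" "h \<in> carrier G" for g h
    using \<alpha> that by (simp add: two_cocycle_def)
  have coc: "\<alpha> g h * \<alpha> (g \<otimes>\<^bsub>G\<^esub> h) k = \<alpha> h k * \<alpha> g (h \<otimes>\<^bsub>G\<^esub> k)"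
    if "g \<in> carrier G" "h \<in> carrier G" "k \<in> carrier G" for g h k
    using \<alpha> that by (simp add: two_cocycle_def)
  have mult: "(x \<otimes>\<^bsub>?A\<^esub> y) k = (\<Sum>g\<in>carrier G. \<Sum>h\<in>carrier G.
      if g \<otimes>\<^bsub>G\<^esub> h = k then x g * y h * \<alpha> g h else 0)" for x y k
    by (simp add: twisted_group_algebra_def)
  have car: "x \<in> carrier ?A \<longleftrightarrow> (\<forall>g. g \<notin> carrier G \<longrightarrow> x g = 0)" for x
    by (simp add: twisted_group_algebra_def)
  define c where "c = \<alpha> \<one>\<^bsub>G\<^esub> \<one>\<^bsub>G\<^esub>"
  have one: "\<one>\<^bsub>?A\<^esub> = (\<lambda>k. if k = \<one>\<^bsub>G\<^esub> then inverse c else 0)"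
    and add: "x \<oplus>\<^bsub>?A\<^esub> y = (\<lambda>k. x k + y k)"
    and zero: "\<zero>\<^bsub>?A\<^esub> = (\<lambda>k. 0)" and smult: "d \<odot>\<^bsub>?A\<^esub> x = (\<lambda>k. d * x k)" for x y d
    by (simp_all add: twisted_group_algebra_def c_def cong: if_cong)
  have \<alpha>1: "\<alpha> \<one>\<^bsub>G\<^esub> h = c" "\<alpha> h \<one>\<^bsub>G\<^esub> = c" if "h \<in> carrier G" for h
    using coc[of "\<one>\<^bsub>G\<^esub>" "\<one>\<^bsub>G\<^esub>" h] coc[of h "\<one>\<^bsub>G\<^esub>" "\<one>\<^bsub>G\<^esub>"] nz that by (simp_all add: c_def)
  have c0: "c \<noteq> 0" using nz by (simp add: c_def)
  have closed: "x \<otimes>\<^bsub>?A\<^esub> y \<in> carrier ?A" for x y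
    unfolding car mult by (auto intro!: sum.neutral)
  have assoc: "(x \<otimes>\<^bsub>?A\<^esub> y) \<otimes>\<^bsub>?A\<^esub> z = x \<otimes>\<^bsub>?A\<^esub> (y \<otimes>\<^bsub>?A\<^esub> z)" for x y z
  proof
    fix m
    have ifm: "(if b then u else 0) * v = (if b then u * v else 0)"
      and ifm': "v * (if b then u else 0) = (if b then v * u else 0)" for b and u v :: complex
      by auto
    let ?S = "carrier G"
    have "((x \<otimes>\<^bsub>?A\<^esub> y) \<otimes>\<^bsub>?A\<^esub> z) m = (\<Sum>p\<in>?S. \<Sum>k\<in>?S. \<Sum>g\<in>?S. \<Sum>h\<in>?S.
        if g \<otimes>\<^bsub>G\<^esub> h = p then (if p \<otimes>\<^bsub>G\<^esub> k = m then x g * y h * \<alpha> g h * z k * \<alpha> p k else 0) else 0)"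
      unfolding mult[of "x \<otimes>\<^bsub>?A\<^esub> y"]
    proof (intro sum.cong refl)
      fix p k show "(if p \<otimes>\<^bsub>G\<^esub> k = m then (x \<otimes>\<^bsub>?A\<^esub> y) p * z k * \<alpha> p k else 0) =
        (\<Sum>g\<in>?S. \<Sum>h\<in>?S. if g \<otimes>\<^bsub>G\<^esub> h = p then
           (if p \<otimes>\<^bsub>G\<^esub> k = m then x g * y h * \<alpha> g h * z k * \<alpha> p k else 0) else 0)"
        by (cases "p \<otimes>\<^bsub>G\<^esub> k = m") (simp_all add: mult sum_distrib_right ifm cong: if_cong)
    qed
    also have "\<dots> = (\<Sum>k\<in>?S. \<Sum>g\<in>?S. \<Sum>h\<in>?S. \<Sum>p\<in>?S.
        if g \<otimes>\<^bsub>G\<^esub> h = p then (if p \<otimes>\<^bsub>G\<^esub> k = m then x g * y h * \<alpha> g h * z k * \<alpha> p k else 0) else 0)"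
      by (rule trans[OF sum.swap], rule sum.cong[OF refl], rule trans[OF sum.swap], rule sum.cong[OF refl], rule sum.swap)
    also have "\<dots> = (\<Sum>k\<in>?S. \<Sum>g\<in>?S. \<Sum>h\<in>?S.
        if g \<otimes>\<^bsub>G\<^esub> h \<otimes>\<^bsub>G\<^esub> k = m then x g * y h * \<alpha> g h * z k * \<alpha> (g \<otimes>\<^bsub>G\<^esub> h) k else 0)"
      using fin by (intro sum.cong refl) simp
    also have "\<dots> = (\<Sum>g\<in>?S. \<Sum>h\<in>?S. \<Sum>k\<in>?S.
        if g \<otimes>\<^bsub>G\<^esub> h \<otimes>\<^bsub>G\<^esub> k = m then x g * y h * \<alpha> g h * z k * \<alpha> (g \<otimes>\<^bsub>G\<^esub> h) k else 0)"
      by (rule trans[OF sum.swap], rule sum.cong[OF refl], rule sum.swap)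
    also have "\<dots> = (\<Sum>g\<in>?S. \<Sum>h\<in>?S. \<Sum>k\<in>?S.
        if g \<otimes>\<^bsub>G\<^esub> (h \<otimes>\<^bsub>G\<^esub> k) = m then x g * (y h * z k * \<alpha> h k) * \<alpha> g (h \<otimes>\<^bsub>G\<^esub> k) else 0)"
    proof (intro sum.cong refl)
      fix g h k assume "g \<in> ?S" "h \<in> ?S" "k \<in> ?S"
      then show "(if g \<otimes>\<^bsub>G\<^esub> h \<otimes>\<^bsub>G\<^esub> k = m then x g * y h * \<alpha> g h * z k * \<alpha> (g \<otimes>\<^bsub>G\<^esub> h) k else 0) =
          (if g \<otimes>\<^bsub>G\<^esub> (h \<otimes>\<^bsub>G\<^esub> k) = m then x g * (y h * z k * \<alpha> h k) * \<alpha> g (h \<otimes>\<^bsub>G\<^esub> k) else 0)"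
        using arg_cong[OF coc[of g h k], of "\<lambda>c. x g * y h * z k * c"] by (simp add: G.m_assoc mult_ac)
    qed
    also have "\<dots> = (\<Sum>g\<in>?S. \<Sum>h\<in>?S. \<Sum>k\<in>?S. \<Sum>p\<in>?S.
        if h \<otimes>\<^bsub>G\<^esub> k = p then (if g \<otimes>\<^bsub>G\<^esub> p = m then x g * (y h * z k * \<alpha> h k) * \<alpha> g p else 0) else 0)"
      using fin by (intro sum.cong refl) simp
    also have "\<dots> = (\<Sum>g\<in>?S. \<Sum>p\<in>?S. \<Sum>h\<in>?S. \<Sum>k\<in>?S.
        if h \<otimes>\<^bsub>G\<^esub> k = p then (if g \<otimes>\<^bsub>G\<^esub> p = m then x g * (y h * z k * \<alpha> h k) * \<alpha> g p else 0) else 0)"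
      by (rule sum.cong[OF refl], rule trans[OF _ sum.swap], rule sum.cong[OF refl], rule sum.swap)
    also have "\<dots> = (x \<otimes>\<^bsub>?A\<^esub> (y \<otimes>\<^bsub>?A\<^esub> z)) m"
      unfolding mult[of x]
    proof (intro sum.cong refl)
      fix g p show "(\<Sum>h\<in>?S. \<Sum>k\<in>?S. if h \<otimes>\<^bsub>G\<^esub> k = p then
           (if g \<otimes>\<^bsub>G\<^esub> p = m then x g * (y h * z k * \<alpha> h k) * \<alpha> g p else 0) else 0) =
        (if g \<otimes>\<^bsub>G\<^esub> p = m then x g * (y \<otimes>\<^bsub>?A\<^esub> z) p * \<alpha> g p else 0)"
        by (cases "g \<otimes>\<^bsub>G\<^esub> p = m")
          (simp_all add: mult sum_distrib_right sum_distrib_left ifm ifm' cong: if_cong)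
    qed
    finally show "((x \<otimes>\<^bsub>?A\<^esub> y) \<otimes>\<^bsub>?A\<^esub> z) m = (x \<otimes>\<^bsub>?A\<^esub> (y \<otimes>\<^bsub>?A\<^esub> z)) m" .
  qed
  have left1: "\<one>\<^bsub>?A\<^esub> \<otimes>\<^bsub>?A\<^esub> x = x" if x: "x \<in> carrier ?A" for x
  proof
    fix k
    have "(\<one>\<^bsub>?A\<^esub> \<otimes>\<^bsub>?A\<^esub> x) k = (\<Sum>g\<in>carrier G. if g = \<one>\<^bsub>G\<^esub> then
       (\<Sum>h\<in>carrier G. if h = k then x k else 0) else 0)"
      unfolding mult one by (intro sum.cong refl) (auto simp: \<alpha>1 c0 intro!: sum.cong sum.neutral)
    also have "\<dots> = x k" using fin x by (simp add: car)
    finally show "(\<one>\<^bsub>?A\<^esub> \<otimes>\<^bsub>?A\<^esub> x) k = x k" .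
  qed
  have right1: "x \<otimes>\<^bsub>?A\<^esub> \<one>\<^bsub>?A\<^esub> = x" if x: "x \<in> carrier ?A" for x
  proof
    fix k
    have "(x \<otimes>\<^bsub>?A\<^esub> \<one>\<^bsub>?A\<^esub>) k = (\<Sum>g\<in>carrier G. \<Sum>h\<in>carrier G. if h = \<one>\<^bsub>G\<^esub> then
       (if g = k then x k else 0) else 0)"
      unfolding mult one by (intro sum.cong refl) (auto simp: \<alpha>1 c0)
    also have "\<dots> = x k" using fin x by (simp add: car)
    finally show "(x \<otimes>\<^bsub>?A\<^esub> \<one>\<^bsub>?A\<^esub>) k = x k" .
  qed
  have ab: "abelian_group ?A"
  proof (rule abelian_groupI)
    fix x assume "x \<in> carrier ?A"
    then show "\<exists>y\<in>carrier ?A. y \<oplus>\<^bsub>?A\<^esub> x = \<zero>\<^bsub>?A\<^esub>"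
      by (intro bexI[of _ "\<lambda>k. - x k"]) (auto simp: add zero car)
  qed (auto simp: add zero car add_ac)
  have "ring ?A"
  proof (rule ringI[OF ab])
    show "monoid ?A"
      by (rule monoidI) (use closed assoc left1 right1 in \<open>auto simp: car one\<close>)
  next
    show "(x \<oplus>\<^bsub>?A\<^esub> y) \<otimes>\<^bsub>?A\<^esub> z = x \<otimes>\<^bsub>?A\<^esub> z \<oplus>\<^bsub>?A\<^esub> y \<otimes>\<^bsub>?A\<^esub> z" for x y z
    proof
      fix k show "((x \<oplus>\<^bsub>?A\<^esub> y) \<otimes>\<^bsub>?A\<^esub> z) k = (x \<otimes>\<^bsub>?A\<^esub> z \<oplus>\<^bsub>?A\<^esub> y \<otimes>\<^bsub>?A\<^esub> z) k"
        unfolding add mult sum.distrib[symmetric] by (intro sum.cong refl) (simp add: ring_distribs)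
    qed
    show "z \<otimes>\<^bsub>?A\<^esub> (x \<oplus>\<^bsub>?A\<^esub> y) = z \<otimes>\<^bsub>?A\<^esub> x \<oplus>\<^bsub>?A\<^esub> z \<otimes>\<^bsub>?A\<^esub> y" for x y z
    proof
      fix k show "(z \<otimes>\<^bsub>?A\<^esub> (x \<oplus>\<^bsub>?A\<^esub> y)) k = (z \<otimes>\<^bsub>?A\<^esub> x \<oplus>\<^bsub>?A\<^esub> z \<otimes>\<^bsub>?A\<^esub> y) k"
        unfolding add mult sum.distrib[symmetric] by (intro sum.cong refl) (simp add: ring_distribs)
    qed
  qed
  moreover have "module complex_ring ?A"
    by (rule moduleI[OF complex_ring_cring ab]) (auto simp: smult car add ring_distribs mult_ac)
  moreover have "(d \<odot>\<^bsub>?A\<^esub> x) \<otimes>\<^bsub>?A\<^esub> y = d \<odot>\<^bsub>?A\<^esub> (x \<otimes>\<^bsub>?A\<^esub> y)"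
      "x \<otimes>\<^bsub>?A\<^esub> (d \<odot>\<^bsub>?A\<^esub> y) = d \<odot>\<^bsub>?A\<^esub> (x \<otimes>\<^bsub>?A\<^esub> y)" for d x y
    unfolding smult fun_eq_iff mult sum_distrib_left by (intro allI sum.cong refl, simp)+
  ultimately show ?thesis
    by (intro complex_algebra.intro complex_algebra_axioms.intro)
qed

lemma graded_algebra_twisted:
  assumes G: "group G" and fin: "finite (carrier G)" and \<alpha>: "two_cocycle G \<alpha>"
  shows "graded_algebra (twisted_grading G \<alpha>)"
proof -
  let ?A = "twisted_group_algebra G \<alpha>" and ?G = "twisted_grading G \<alpha>"
  interpret G: group G by (rule G)
  interpret A: complex_algebra ?A by (rule complex_algebra_twisted[OF assms])
  have s: "alg ?G = ?A" "grp ?G = G" and c: "cmp ?G g = {x. \<forall>k. k \<noteq> g \<longrightarrow> x k = 0}" for g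
    by (simp_all add: twisted_grading_def)
  have cA: "x \<in> carrier ?A" if "x \<in> cmp ?G g" "g \<in> carrier G" for x g
    using that by (auto simp: c twisted_group_algebra_def)
  have fs: "finsum ?A f S k = (\<Sum>g\<in>S. f g k)" if "finite S" "\<And>g. g \<in> S \<Longrightarrow> f g \<in> carrier ?A" for f S k
    using that
  proof (induction rule: finite_induct)
    case (insert g S)
    then show ?case by (simp add: A.finsum_insert Pi_iff) (simp add: twisted_group_algebra_def)
  qed (simp, simp add: twisted_group_algebra_def)
  have fs': "finsum ?A f (carrier G) k = f k k"
    if f: "\<And>g. g \<in> carrier G \<Longrightarrow> f g \<in> cmp ?G g" and k: "k \<in> carrier G" for f k
  proof -
    have "finsum ?A f (carrier G) k = (\<Sum>g\<in>carrier G. f g k)"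
      using fin f cA by (intro fs) blast+
    also have "\<dots> = (\<Sum>g\<in>carrier G. if g = k then f k k else 0)"
      using f by (intro sum.cong refl) (auto simp: c)
    finally show ?thesis using fin k by simp
  qed
  show ?thesis
  proof (rule graded_algebraI, unfold s)
    fix g assume g: "g \<in> carrier G"
    show "submodule (cmp ?G g) complex_ring ?A"
    proof (rule A.submoduleI)
      fix x assume x: "x \<in> cmp ?G g"
      have "\<ominus>\<^bsub>?A\<^esub> x = (\<lambda>k. - x k)"
        by (rule A.minus_equality) (use x g in \<open>auto simp: c twisted_group_algebra_def\<close>)
      then show "\<ominus>\<^bsub>?A\<^esub> x \<in> cmp ?G g" using x by (simp add: c)
    qed (use g in \<open>auto simp: c twisted_group_algebra_def\<close>)
  next
    fix g h x y assume "g \<in> carrier G" "h \<in> carrier G" "x \<in> cmp ?G g" "y \<in> cmp ?G h"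
    then show "x \<otimes>\<^bsub>?A\<^esub> y \<in> cmp ?G (g \<otimes>\<^bsub>G\<^esub> h)"
      by (auto simp: c twisted_group_algebra_def intro!: sum.neutral) metis
  next
    fix x assume x: "x \<in> carrier ?A"
    define f where "f g = (\<lambda>k. if k = g then x k else 0)" for g
    have f: "f g \<in> cmp ?G g" for g by (simp add: c f_def)
    have "x = finsum ?A f (carrier G)"
    proof
      fix k
      have "finsum ?A f (carrier G) \<in> carrier ?A"
        by (rule A.finsum_closed) (use f cA in auto)
      then have "k \<notin> carrier G \<Longrightarrow> finsum ?A f (carrier G) k = 0" "k \<notin> carrier G \<Longrightarrow> x k = 0"
        using x by (auto simp: twisted_group_algebra_def)
      then show "x k = finsum ?A f (carrier G) k"
        using fs'[of f k] f by (cases "k \<in> carrier G") (auto simp: f_def)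
    qed
    then show "\<exists>f. (\<forall>g\<in>carrier G. f g \<in> cmp ?G g) \<and> x = finsum ?A f (carrier G)"
      using f by blast
  next
    fix f f' g
    assume f: "\<And>g. g \<in> carrier G \<Longrightarrow> f g \<in> cmp ?G g" and f': "\<And>g. g \<in> carrier G \<Longrightarrow> f' g \<in> cmp ?G g"
      and eq: "finsum ?A f (carrier G) = finsum ?A f' (carrier G)" and g: "g \<in> carrier G"
    have "f g g = f' g g" using fs'[OF f g] fs'[OF f' g] eq by simp
    moreover have "f g k = 0" "f' g k = 0" if "k \<noteq> g" for k
      using f[OF g] f'[OF g] that by (auto simp: c)
    ultimately show "f g = f' g" by (metis ext)
  qed (use G fin A.complex_algebra_axioms in auto)
qed

end

theory Submission
  imports Defs "HOL-Algebra.Multiplicative_Group"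
begin

text \<open>
  Given a bijective cocycle \<open>\<delta>\<close> of \<open>H\<close> with values in \<open>M\<close>, let \<open>G\<close> be the semidirect product
  of the dual of \<open>M\<close> with \<open>H\<close>, and send \<open>(\<chi>, a)\<close> to the diagonal matrix with entries
  \<open>\<chi> (\<delta> h\<^sub>i)\<close> times the permutation matrix of left translation by \<open>a\<close>, which is homogeneous of
  degree \<open>a\<close>. By the cocycle identity these matrices multiply projectively, and by character
  orthogonality they form a basis of the matrix algebra.

  Conversely, let a twisted group algebra of \<open>G\<close> have the elementary grading as a quotient via
  \<open>\<phi>\<close>, and let \<open>N\<close> be the kernel of \<open>\<phi>\<close>. The basis elements \<open>u\<^sub>x\<close> with \<open>x\<close> in \<open>N\<close>
  become diagonal matrices, so \<open>N\<close> is abelian, and every \<open>b\<close> in \<open>H\<close> gives a character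
  \<open>\<delta> b\<close> of \<open>N\<close>, the ratio of the diagonal entries of \<open>u\<^sub>x\<close> at \<open>b\<close> and at \<open>1\<close>. Distinct \<open>b\<close>
  give distinct characters because the \<open>u\<^sub>x\<close> span the diagonal; every character occurs because
  one orthogonal to all \<open>\<delta> b\<close> would give a linear relation among the \<open>u\<^sub>x\<close>. Conjugation by
  a lift of \<open>b\<close> to \<open>G\<close> permutes the diagonal entries by left translation, which is the cocycle
  identity for \<open>\<delta>\<close>.
\<close>

subsection \<open>Characters of finite abelian groups\<close>

text \<open>Nonvanishing excludes the zero map, which is multiplicative too; what remains are
  homomorphisms into the multiplicative group of the complex numbers.\<close>

definition character :: "('m, 'b) monoid_scheme \<Rightarrow> ('m \<Rightarrow> complex) \<Rightarrow> bool" where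
  "character M \<chi> \<longleftrightarrow> (\<forall>x\<in>carrier M. \<chi> x \<noteq> 0) \<and>
     (\<forall>x\<in>carrier M. \<forall>y\<in>carrier M. \<chi> (x \<otimes>\<^bsub>M\<^esub> y) = \<chi> x * \<chi> y)"

text \<open>Extensionality identifies characters that agree on the group; without it the carrier
  could be infinite because of junk values.\<close>

definition dual_group :: "('m, 'b) monoid_scheme \<Rightarrow> ('m \<Rightarrow> complex) monoid" where
  "dual_group M = \<lparr>carrier = {\<chi> \<in> extensional (carrier M). character M \<chi>},
     monoid.mult = (\<lambda>\<chi> \<xi>. \<lambda>x\<in>carrier M. \<chi> x * \<xi> x), one = (\<lambda>x\<in>carrier M. 1)\<rparr>"

lemma dual_group_simps [simp]:
  "\<chi> \<in> carrier (dual_group M) \<longleftrightarrow> \<chi> \<in> extensional (carrier M) \<and> character M \<chi>"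
  "\<chi> \<otimes>\<^bsub>dual_group M\<^esub> \<xi> = (\<lambda>x\<in>carrier M. \<chi> x * \<xi> x)"
  "\<one>\<^bsub>dual_group M\<^esub> = (\<lambda>x\<in>carrier M. 1)"
  by (simp_all add: dual_group_def)

lemma character_nonzero: "character M \<chi> \<Longrightarrow> x \<in> carrier M \<Longrightarrow> \<chi> x \<noteq> 0"
  and character_mult: "character M \<chi> \<Longrightarrow> x \<in> carrier M \<Longrightarrow> y \<in> carrier M \<Longrightarrow> \<chi> (x \<otimes>\<^bsub>M\<^esub> y) = \<chi> x * \<chi> y"
  by (simp_all add: character_def)

context group
begin

lemma character_one:
  assumes "character G \<chi>"
  shows "\<chi> \<one> = 1"
  using character_mult[OF assms one_closed one_closed] character_nonzero[OF assms one_closed] by simp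

lemma character_inv:
  assumes "character G \<chi>" "x \<in> carrier G"
  shows "\<chi> (inv x) = inverse (\<chi> x)"
  using character_mult[OF assms(1) assms(2) inv_closed[OF assms(2)]] assms character_one[OF assms(1)]
  by (simp add: inverse_unique)

lemma character_nat_pow:
  assumes "character G \<chi>" "x \<in> carrier G"
  shows "\<chi> (x [^] (k::nat)) = \<chi> x ^ k"
  using assms by (induction k) (simp_all add: character_one character_mult)

lemma comm_group_dual: "comm_group (dual_group G)"
proof (rule comm_groupI)
  fix \<chi> assume \<chi>: "\<chi> \<in> carrier (dual_group G)"
  show "\<exists>\<xi>\<in>carrier (dual_group G). \<xi> \<otimes>\<^bsub>dual_group G\<^esub> \<chi> = \<one>\<^bsub>dual_group G\<^esub>"
    by (rule bexI[of _ "\<lambda>x\<in>carrier G. inverse (\<chi> x)"])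
      (use \<chi> in \<open>auto simp: character_def fun_eq_iff\<close>)
qed (auto simp: character_def fun_eq_iff extensional_def)

text \<open>Every value of a character is a root of unity of exponent \<open>order G\<close>, so the
  dual lies in a finite function space.\<close>

lemma finite_dual_group:
  assumes fin: "finite (carrier G)"
  shows "finite (carrier (dual_group G))"
proof -
  have "order G > 0" using fin by (simp add: order_gt_0_iff_finite)
  then have "finite {z :: complex. z ^ order G = 1}"
    by (intro finite_roots_unity) simp
  then have "finite (carrier G \<rightarrow>\<^sub>E {z :: complex. z ^ order G = 1})"
    using fin by (intro finite_PiE)
  moreover have "carrier (dual_group G) \<subseteq> carrier G \<rightarrow>\<^sub>E {z. z ^ order G = 1}"
    by (auto simp: PiE_def Pi_def character_one pow_order_eq_1 simp flip: character_nat_pow)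
  ultimately show ?thesis by (rule finite_subset[rotated])
qed

text \<open>Translation by \<open>a\<close> permutes the summands and multiplies the sum by
  \<open>\<chi> a\<close>, which is not 1.\<close>

lemma sum_character_eq_0:
  assumes \<chi>: "character G \<chi>" and a: "a \<in> carrier G" "\<chi> a \<noteq> 1"
  shows "(\<Sum>x\<in>carrier G. \<chi> x) = 0"
proof -
  have "(\<Sum>x\<in>carrier G. \<chi> x) = (\<Sum>x\<in>carrier G. \<chi> (a \<otimes> x))"
    using a by (intro sum.reindex_bij_witness[of _ "\<lambda>x. a \<otimes> x" "\<lambda>x. inv a \<otimes> x"])
      (auto simp flip: m_assoc)
  also have "\<dots> = \<chi> a * (\<Sum>x\<in>carrier G. \<chi> x)"
    using a \<chi> by (simp add: sum_distrib_left character_mult)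
  finally show ?thesis using a(2) by simp
qed

text \<open>The quotient of two distinct characters is a nontrivial character, so its sum vanishes.
  \<open>inverse\<close> takes the place of complex conjugation.\<close>

lemma character_orthogonality:
  assumes "\<chi> \<in> carrier (dual_group G)" "\<xi> \<in> carrier (dual_group G)"
  shows "(\<Sum>x\<in>carrier G. \<chi> x * inverse (\<xi> x)) = (if \<chi> = \<xi> then of_nat (order G) else 0)"
proof (cases "\<chi> = \<xi>")
  case True
  have "(\<Sum>x\<in>carrier G. \<chi> x * inverse (\<xi> x)) = (\<Sum>x\<in>carrier G. 1)"
    using True assms by (intro sum.cong) (simp_all add: character_def)
  then show ?thesis using True by (simp add: order_def)
next
  case False
  then obtain a where a: "a \<in> carrier G" "\<chi> a \<noteq> \<xi> a"
    using assms by (auto intro: extensionalityI)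
  have "character G (\<lambda>x. \<chi> x * inverse (\<xi> x))"
    using assms by (auto simp: character_def)
  then have "(\<Sum>x\<in>carrier G. \<chi> x * inverse (\<xi> x)) = 0"
    by (rule sum_character_eq_0[OF _ a(1)])
      (use a assms in \<open>auto simp: character_def field_simps\<close>)
  with False show ?thesis by simp
qed

end

section \<open>Extending characters of finite abelian groups\<close>

lemma complex_nth_root_exists:
  fixes w :: complex
  assumes "k > 0"
  obtains z where "z ^ k = w"
proof
  show "rcis (root k (cmod w)) (Arg w / k) ^ k = w"
    using assms by (simp add: DeMoivre2 rcis_cmod_Arg)
qed

context comm_group
begin

text \<open>Adjoins one element \<open>x\<close> to \<open>A\<close>. The powers of \<open>x\<close>
  in \<open>A\<close> are those with exponent divisible by \<open>k\<close>, so the equation for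
  \<open>\<zeta>\<close> is the only constraint on the value at \<open>x\<close>. That value is a
  parameter: extending takes any root, separating points takes a root other than 1.\<close>

lemma character_extend_step:
  assumes fin: "finite (carrier G)" and A: "subgroup A G" and \<chi>: "character (G\<lparr>carrier := A\<rparr>) \<chi>"
    and x: "x \<in> carrier G" and k: "\<And>i::nat. x [^] i \<in> A \<longleftrightarrow> k dvd i"
    and \<zeta>: "\<zeta> ^ k = \<chi> (x [^] k)"
  obtains B \<xi> where "subgroup B G" "A \<subseteq> B" "x \<in> B" "character (G\<lparr>carrier := B\<rparr>) \<xi>"
    "\<And>a. a \<in> A \<Longrightarrow> \<xi> a = \<chi> a" "\<xi> x = \<zeta>"
proof -
  let ?A = "G\<lparr>carrier := A\<rparr>"
  interpret A: subgroup A G by (rule A)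
  interpret GA: group ?A using A by (rule subgroup_imp_group)
  have Ac: "a \<in> carrier G" if "a \<in> A" for a using A.subset that by blast
  have \<chi>m: "\<chi> (a \<otimes> b) = \<chi> a * \<chi> b" if "a \<in> A" "b \<in> A" for a b
    using character_mult[OF \<chi>] that by simp
  have \<chi>0: "\<chi> a \<noteq> 0" if "a \<in> A" for a
    using character_nonzero[OF \<chi>] that by simp
  have \<chi>1: "\<chi> \<one> = 1" using GA.character_one[OF \<chi>] by simp
  have k0: "x [^] k \<in> A" using k by simp
  \<comment> \<open>With \<open>k = 0\<close> no positive power of \<open>x\<close> would lie in
    \<open>A\<close>, but \<open>x [^] order G\<close> is the unit.\<close>
  have "k \<noteq> 0" using k[of "order G"] fin x pow_order_eq_1[OF x] order_gt_0_iff_finite by fastforce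
  have \<zeta>0: "\<zeta> \<noteq> 0"
    using \<zeta> \<chi>0[OF k0] \<open>k \<noteq> 0\<close> by (auto simp: zero_power)
  \<comment> \<open>makes \<open>\<xi> (a \<otimes> x [^] i) = \<chi> a * \<zeta> ^ i\<close> well defined on the subgroup generated by \<open>A\<close> and \<open>x\<close>\<close>
  have key: "\<chi> (x [^] i) = \<zeta> ^ i" if "x [^] i \<in> A" for i
  proof -
    have "k dvd i" using that k by simp
    then obtain j where j: "i = k * j" by (rule dvdE)
    have "\<chi> ((x [^] k) [^] j) = \<chi> (x [^] k) ^ j"
      using GA.character_nat_pow[OF \<chi>, of "x [^] k" j] k0 by (simp flip: nat_pow_consistent)
    then show ?thesis using x by (simp add: j nat_pow_pow power_mult \<zeta>)
  qed
  \<comment> \<open>Cancelling \<open>x [^] i\<close> shows that \<open>x [^] (j - i)\<close> lies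
    in \<open>A\<close>, where \<open>key\<close> gives its value.\<close>
  have wd0: "\<chi> a * \<zeta> ^ i = \<chi> b * \<zeta> ^ j"
    if "a \<in> A" "b \<in> A" "a \<otimes> x [^] i = b \<otimes> x [^] j" "i \<le> j" for a b and i j :: nat
  proof -
    have "x [^] j = x [^] (j - i) \<otimes> x [^] i" using x \<open>i \<le> j\<close> by (simp add: nat_pow_mult)
    then have "a \<otimes> x [^] i = (b \<otimes> x [^] (j - i)) \<otimes> x [^] i"
      using that x Ac by (simp add: m_assoc)
    then have a: "a = b \<otimes> x [^] (j - i)" using that x Ac by simp
    have "x [^] (j - i) = inv b \<otimes> a" unfolding a using that x Ac by (simp flip: m_assoc)
    then have xA: "x [^] (j - i) \<in> A" using that by simp
    have "\<chi> a = \<chi> b * \<zeta> ^ (j - i)" using a that xA by (simp add: \<chi>m key)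
    then show ?thesis using \<open>i \<le> j\<close> by (simp flip: power_add)
  qed
  have wd: "\<chi> a * \<zeta> ^ i = \<chi> b * \<zeta> ^ j"
    if "a \<in> A" "b \<in> A" "a \<otimes> x [^] i = b \<otimes> x [^] j" for a b and i j :: nat
    using wd0[of a b i j] wd0[of b a j i] that by (cases "i \<le> j") auto
  \<comment> \<open>Natural exponents suffice for a subgroup because \<open>x\<close> has finite
    order. \<open>\<xi>\<close> picks an arbitrary presentation of its argument; by
    \<open>wd\<close> the choice does not matter.\<close>
  define B where "B = {a \<otimes> x [^] i | a i. a \<in> A \<and> i \<in> (UNIV :: nat set)}"
  define \<xi> where "\<xi> y = (SOME z. \<exists>a i. a \<in> A \<and> y = a \<otimes> x [^] (i::nat) \<and> z = \<chi> a * \<zeta> ^ i)" for y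
  have \<xi>: "\<xi> (a \<otimes> x [^] i) = \<chi> a * \<zeta> ^ i" if "a \<in> A" for a and i :: nat
    unfolding \<xi>_def
  proof (rule someI2)
    show "\<exists>a' i'. a' \<in> A \<and> a \<otimes> x [^] i = a' \<otimes> x [^] (i'::nat) \<and> \<chi> a * \<zeta> ^ i = \<chi> a' * \<zeta> ^ i'"
      using that by blast
  qed (use that wd in metis)
  have mult: "(a \<otimes> x [^] i) \<otimes> (b \<otimes> x [^] j) = (a \<otimes> b) \<otimes> x [^] (i + j)"
    if "a \<in> A" "b \<in> A" for a b and i j :: nat
    using that x Ac by (simp add: m_ac flip: nat_pow_mult)
  show thesis
  proof
    show AB: "A \<subseteq> B"
    proof
      fix a assume "a \<in> A"
      then have "a = a \<otimes> x [^] (0::nat)" using Ac by simp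
      then show "a \<in> B" using \<open>a \<in> A\<close> unfolding B_def by blast
    qed
    have xB: "x = \<one> \<otimes> x [^] (1::nat)" using x by simp
    then show "x \<in> B" unfolding B_def using A.one_closed by blast
    show "subgroup B G"
    proof (rule subgroupI)
      show "B \<subseteq> carrier G" using Ac x by (auto simp: B_def)
      show "B \<noteq> {}" using AB A.one_closed by blast
    next
      fix y z assume "y \<in> B" "z \<in> B"
      then show "y \<otimes> z \<in> B" unfolding B_def using mult by (auto, metis A.m_closed)
    next
      fix y assume "y \<in> B"
      then obtain a i where a: "a \<in> A" "y = a \<otimes> x [^] (i::nat)" by (auto simp: B_def)
      have "x [^] i \<otimes> x [^] (i * (order G - 1)) = x [^] (i * order G)"
        using fin x order_gt_0_iff_finite by (cases "order G") (auto simp: nat_pow_mult)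
      also have "\<dots> = \<one>"
        using x by (simp add: mult.commute pow_order_eq_1 flip: nat_pow_pow)
      finally have "inv (x [^] i) = x [^] (i * (order G - 1))"
        using x by (metis inv_unique' nat_pow_closed m_comm)
      then have "inv y = inv a \<otimes> x [^] (i * (order G - 1))"
        using a x Ac by (simp add: inv_mult)
      then show "inv y \<in> B" unfolding B_def using a A.m_inv_closed by blast
    qed
    show "\<xi> x = \<zeta>" using \<xi>[OF A.one_closed, of 1] x by (simp add: \<chi>1)
    show "\<xi> a = \<chi> a" if "a \<in> A" for a using \<xi>[OF that, of 0] Ac[OF that] by simp
    show "character (G\<lparr>carrier := B\<rparr>) \<xi>"
      unfolding character_def
      by (auto simp: B_def \<xi> \<chi>0 \<zeta>0 mult \<chi>m power_add)
  qed
qed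

text \<open>\<open>k\<close> is the order of \<open>x\<close> modulo \<open>A\<close>. Division by
  the least positive exponent leaves a remainder that is again an exponent into \<open>A\<close>,
  hence 0.\<close>

lemma least_power_in_subgroup:
  assumes fin: "finite (carrier G)" and A: "subgroup A G" and x: "x \<in> carrier G"
  obtains k :: nat where "k > 0" "\<And>i::nat. x [^] i \<in> A \<longleftrightarrow> k dvd i"
proof -
  interpret A: subgroup A G by (rule A)
  define k where "k = (LEAST i::nat. i > 0 \<and> x [^] i \<in> A)"
  have "order G > 0 \<and> x [^] order G \<in> A"
    using fin x by (simp add: order_gt_0_iff_finite pow_order_eq_1)
  then have k: "k > 0 \<and> x [^] k \<in> A" unfolding k_def by (rule LeastI)
  have pw: "x [^] (k * j) \<in> A" for j
  proof (induction j)
    case (Suc j)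
    have "x [^] (k * Suc j) = x [^] k \<otimes> x [^] (k * j)" using x by (simp add: nat_pow_mult)
    then show ?case using Suc k by simp
  qed simp
  have "k dvd i" if i: "x [^] i \<in> A" for i :: nat
  proof (rule ccontr)
    assume "\<not> k dvd i"
    then have pos: "i mod k > 0" by (simp add: mod_greater_zero_iff_not_dvd)
    have "x [^] i = x [^] (k * (i div k)) \<otimes> x [^] (i mod k)" using x by (simp add: nat_pow_mult)
    then have "x [^] (i mod k) = inv (x [^] (k * (i div k))) \<otimes> x [^] i"
      using x by (simp flip: m_assoc)
    then have "x [^] (i mod k) \<in> A" using i pw by simp
    then have "k \<le> i mod k" using pos Least_le[of "\<lambda>i. i > 0 \<and> x [^] i \<in> A" "i mod k", folded k_def] by blast
    then show False using k by (meson mod_less_divisor not_le)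
  qed
  then show thesis using that[of k] k pw by (metis dvdE)
qed

text \<open>Induction on the number of elements outside \<open>A\<close>. The step never gets stuck,
  since every complex number has a \<open>k\<close>-th root.\<close>

lemma character_extend:
  assumes fin: "finite (carrier G)" and "subgroup A G" "character (G\<lparr>carrier := A\<rparr>) \<chi>"
  obtains \<xi> where "character G \<xi>" "\<And>a. a \<in> A \<Longrightarrow> \<xi> a = \<chi> a"
  using assms(2,3)
proof (induction "card (carrier G - A)" arbitrary: A \<chi> thesis rule: less_induct)
  case (less A \<chi>)
  have AG: "A \<subseteq> carrier G" using less.prems(2) by (rule subgroup.subset)
  show ?case
  proof (cases "A = carrier G")
    case True
    then show ?thesis using less.prems by simp
  next
    case False
    then obtain x where x: "x \<in> carrier G" "x \<notin> A" using AG by blast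
    obtain k where k: "k > 0" "\<And>i::nat. x [^] i \<in> A \<longleftrightarrow> k dvd i"
      using least_power_in_subgroup[OF fin less.prems(2) x(1)] by metis
    obtain \<zeta> where \<zeta>: "\<zeta> ^ k = \<chi> (x [^] k)" using complex_nth_root_exists[OF k(1)] .
    obtain B \<xi> where B: "subgroup B G" "A \<subseteq> B" "x \<in> B" "character (G\<lparr>carrier := B\<rparr>) \<xi>"
      "\<And>a. a \<in> A \<Longrightarrow> \<xi> a = \<chi> a"
      using character_extend_step[OF fin less.prems(2,3) x(1) k(2) \<zeta>] by metis
    have "card (carrier G - B) < card (carrier G - A)"
      using fin x B(2,3) by (intro psubset_card_mono) auto
    then obtain \<xi>' where "character G \<xi>'" "\<And>a. a \<in> B \<Longrightarrow> \<xi>' a = \<xi> a"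
      using less.hyps[OF _ _ B(1,4)] by metis
    then show ?thesis using less.prems(1)[of \<xi>'] B(2,5) by (metis subsetD)
  qed
qed

text \<open>Over the trivial subgroup \<open>k\<close> is the order of \<open>x\<close>, which
  exceeds 1, so some \<open>k\<close>-th root of unity differs from 1. Prescribe it at
  \<open>x\<close> and extend to the whole group.\<close>

lemma characters_separate:
  assumes fin: "finite (carrier G)" and x: "x \<in> carrier G" "x \<noteq> \<one>"
  obtains \<chi> where "\<chi> \<in> carrier (dual_group G)" "\<chi> x \<noteq> 1"
proof -
  have 1: "subgroup {\<one>} G" by (rule triv_subgroup)
  have c1: "character (G\<lparr>carrier := {\<one>}\<rparr>) (\<lambda>x. 1)" by (simp add: character_def)
  obtain k where k: "k > 0" "\<And>i::nat. x [^] i \<in> {\<one>} \<longleftrightarrow> k dvd i"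
    using least_power_in_subgroup[OF fin 1 x(1)] by metis
  have "k \<noteq> 1" using k(2)[of 1] x by auto
  then have "card {z::complex. z ^ k = 1} > 1" using k(1) card_roots_unity_eq[of k] by simp
  then have "\<not> {z::complex. z ^ k = 1} \<subseteq> {1}"
    using card_mono[of "{1::complex}" "{z. z ^ k = 1}"] by auto
  then obtain \<zeta> :: complex where \<zeta>: "\<zeta> ^ k = 1" "\<zeta> \<noteq> 1" by blast
  obtain B \<xi> where B: "subgroup B G" "x \<in> B" "character (G\<lparr>carrier := B\<rparr>) \<xi>" "\<xi> x = \<zeta>"
    using character_extend_step[OF fin 1 c1 x(1) k(2) \<zeta>(1)] by metis
  obtain \<chi> where \<chi>: "character G \<chi>" "\<chi> x = \<zeta>"
    using character_extend[OF fin B(1,3)] B(2,4) by metis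
  have "restrict \<chi> (carrier G) \<in> carrier (dual_group G)"
    using \<chi>(1) by (simp add: character_def)
  then show thesis by (rule that) (use x \<chi> \<zeta> in simp)
qed

text \<open>Evaluation at \<open>x\<close> is a character of the dual group, nontrivial by
  \<open>characters_separate\<close> when \<open>x\<close> is not the unit.\<close>

lemma sum_dual_group:
  assumes fin: "finite (carrier G)" and x: "x \<in> carrier G"
  shows "(\<Sum>\<chi>\<in>carrier (dual_group G). \<chi> x) = (if x = \<one> then of_nat (order (dual_group G)) else 0)"
proof (cases "x = \<one>")
  case True
  then show ?thesis by (simp add: character_one order_def)
next
  case False
  interpret D: comm_group "dual_group G" by (rule comm_group_dual)
  obtain \<chi> where \<chi>: "\<chi> \<in> carrier (dual_group G)" "\<chi> x \<noteq> 1"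
    using characters_separate[OF fin x False] .
  have "character (dual_group G) (\<lambda>\<chi>. \<chi> x)"
    using x by (auto simp: character_def)
  from D.sum_character_eq_0[OF this \<chi>] show ?thesis using False by simp
qed

text \<open>Sum \<open>\<chi> x\<close> over all pairs: summing over \<open>\<chi>\<close> first
  gives the order of the dual, over \<open>x\<close> first the order of \<open>G\<close>.\<close>

lemma order_dual_group:
  assumes fin: "finite (carrier G)"
  shows "order (dual_group G) = order G"
proof -
  let ?D = "dual_group G"
  interpret D: comm_group ?D by (rule comm_group_dual)
  have "(of_nat (order ?D) :: complex) = (\<Sum>x\<in>carrier G. if x = \<one> then of_nat (order ?D) else 0)"
    using fin by simp
  also have "\<dots> = (\<Sum>x\<in>carrier G. \<Sum>\<chi>\<in>carrier ?D. \<chi> x)"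
    using fin by (intro sum.cong refl) (simp add: sum_dual_group)
  also have "\<dots> = (\<Sum>\<chi>\<in>carrier ?D. \<Sum>x\<in>carrier G. \<chi> x)" by (rule sum.swap)
  also have "\<dots> = (\<Sum>\<chi>\<in>carrier ?D. if \<chi> = \<one>\<^bsub>?D\<^esub> then of_nat (order G) else 0)"
  proof (rule sum.cong[OF refl])
    fix \<chi> assume "\<chi> \<in> carrier ?D"
    from character_orthogonality[OF this D.one_closed]
    show "(\<Sum>x\<in>carrier G. \<chi> x) = (if \<chi> = \<one>\<^bsub>?D\<^esub> then of_nat (order G) else 0)" by simp
  qed
  also have "\<dots> = of_nat (order G)"
    using finite_dual_group[OF fin] D.one_closed by (simp del: dual_group_simps)
  finally show ?thesis by (simp only: of_nat_eq_iff)
qed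

text \<open>The column relation of the character table. Together with the row relation it supplies
  the two-sided inverse that \<open>twisted_algebra_iso_matrixI\<close> asks for.\<close>

lemma dual_orthogonality:
  assumes fin: "finite (carrier G)" and x: "x \<in> carrier G" and y: "y \<in> carrier G"
  shows "(\<Sum>\<chi>\<in>carrier (dual_group G). \<chi> x * inverse (\<chi> y)) = (if x = y then of_nat (order G) else 0)"
proof -
  have "(\<Sum>\<chi>\<in>carrier (dual_group G). \<chi> x * inverse (\<chi> y)) =
      (\<Sum>\<chi>\<in>carrier (dual_group G). \<chi> (x \<otimes> inv y))"
    using x y by (intro sum.cong) (simp_all add: character_mult character_inv)
  also have "\<dots> = (if x \<otimes> inv y = \<one> then of_nat (order G) else 0)"
    using x y fin by (simp add: sum_dual_group order_dual_group del: dual_group_simps)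
  also have "x \<otimes> inv y = \<one> \<longleftrightarrow> x = y"
    using x y by (metis inv_closed inv_equality inv_inv r_inv)
  finally show ?thesis .
qed

end

subsection \<open>From a quotient morphism to a bijective cocycle\<close>

text \<open>The action laws make the action of the inverse of \<open>g\<close> a two-sided inverse
  of \<open>act g\<close>, which gives bijectivity.\<close>

lemma hom_AutoGroupI:
  assumes H: "group H" and hom: "\<And>g. g \<in> carrier H \<Longrightarrow> act g \<in> hom M M"
    and ext: "\<And>g. g \<in> carrier H \<Longrightarrow> act g \<in> extensional (carrier M)"
    and comp: "\<And>g h x. \<lbrakk>g \<in> carrier H; h \<in> carrier H; x \<in> carrier M\<rbrakk>
      \<Longrightarrow> act (g \<otimes>\<^bsub>H\<^esub> h) x = act g (act h x)"
    and one: "\<And>x. x \<in> carrier M \<Longrightarrow> act \<one>\<^bsub>H\<^esub> x = x"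
  shows "act \<in> hom H (AutoGroup M)"
  unfolding hom_AutoGroup_iff
proof (intro conjI ballI)
  interpret H: group H by (rule H)
  have cl: "act g x \<in> carrier M" if "g \<in> carrier H" "x \<in> carrier M" for g x
    using hom[OF that(1)] that(2) by (rule hom_in_carrier)
  show "act g \<in> auto M" if g: "g \<in> carrier H" for g
  proof -
    have "bij_betw (act g) (carrier M) (carrier M)"
      by (rule bij_betw_byWitness[where f' = "act (inv\<^bsub>H\<^esub> g)"])
        (use g cl in \<open>auto simp: one simp flip: comp\<close>)
    then show ?thesis using hom[OF g] ext[OF g] by (simp add: auto_def Bij_def)
  qed
  show "act (g \<otimes>\<^bsub>H\<^esub> h) = compose (carrier M) (act g) (act h)"
    if "g \<in> carrier H" "h \<in> carrier H" for g h
    using that by (intro extensionalityI[of _ "carrier M"]) (simp_all add: ext comp compose_def)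
qed

text \<open>
  The entry \<open>v g c\<close> is the only nonzero one in column \<open>c\<close> of the monomial matrix of \<open>g\<close>; it is
  in row \<open>\<phi> g \<otimes> c\<close>.
\<close>

lemma IYB_of_monomial_representation:
  fixes G :: "'g monoid" and H :: "'a monoid" and v :: "'g \<Rightarrow> 'a \<Rightarrow> complex"
  assumes G: "group G" and finG: "finite (carrier G)" and H: "group H" and finH: "finite (carrier H)"
    and \<phi>: "\<phi> \<in> epi G H"
    and mult: "\<And>g g' c. \<lbrakk>g \<in> carrier G; g' \<in> carrier G; c \<in> carrier H\<rbrakk>
      \<Longrightarrow> v g (\<phi> g' \<otimes>\<^bsub>H\<^esub> c) * v g' c = \<alpha> g g' * v (g \<otimes>\<^bsub>G\<^esub> g') c"
    and nz: "\<And>g c. \<lbrakk>g \<in> carrier G; c \<in> carrier H\<rbrakk> \<Longrightarrow> v g c \<noteq> 0"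
    and indep: "\<And>a x. \<lbrakk>\<And>c. c \<in> carrier H \<Longrightarrow> (\<Sum>x\<in>kernel G H \<phi>. a x * v x c) = 0; x \<in> kernel G H \<phi>\<rbrakk>
      \<Longrightarrow> a x = 0"
    and sep: "\<And>b c. \<lbrakk>b \<in> carrier H; c \<in> carrier H; b \<noteq> c\<rbrakk> \<Longrightarrow> \<exists>x\<in>kernel G H \<phi>. v x b \<noteq> v x c"
  shows "IYB H"
proof -
  interpret G: group G by (rule G)
  interpret H: group H by (rule H)
  have \<phi>h: "\<phi> \<in> hom G H" and surj: "\<phi> ` carrier G = carrier H" using \<phi> by (auto simp: epi_def)
  interpret \<phi>: group_hom G H \<phi> by unfold_locales (rule \<phi>h)
  define N where "N = kernel G H \<phi>"
  let ?N = "G\<lparr>carrier := N\<rparr>"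
  have nN: "N \<lhd> G" unfolding N_def by (rule \<phi>.normal_kernel)
  have sN: "subgroup N G" using nN by (rule normal_imp_subgroup)
  interpret N: subgroup N G by (rule sN)
  interpret NG: group ?N using sN by (rule G.subgroup_imp_group)
  have finN: "finite N" using finG N.subset by (rule finite_subset[rotated])
  have Nc: "x \<in> carrier G" and N\<phi>: "\<phi> x = \<one>\<^bsub>H\<^esub>" if "x \<in> N" for x
    using that unfolding N_def kernel_def by blast+
  have NI: "x \<in> N" if "x \<in> carrier G" "\<phi> x = \<one>\<^bsub>H\<^esub>" for x
    using that unfolding N_def kernel_def by blast
  note indep = indep[folded N_def] and sep = sep[folded N_def]
  \<comment> \<open>\<open>\<alpha>\<close> is an arbitrary function here; its values are nonzero
    because those of \<open>v\<close> are.\<close>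
  have \<alpha>0: "\<alpha> g g' \<noteq> 0" if "g \<in> carrier G" "g' \<in> carrier G" for g g'
    using mult[OF that H.one_closed] nz[of g "\<phi> g'"] nz[of g' "\<one>\<^bsub>H\<^esub>"] that by auto
  have multN: "v x c * v y c = \<alpha> x y * v (x \<otimes>\<^bsub>G\<^esub> y) c" if "x \<in> N" "y \<in> N" "c \<in> carrier H" for x y c
    using mult[of x y c] that by (simp add: Nc N\<phi>)
  \<comment> \<open>Elements of \<open>N\<close> act by diagonal matrices, which commute. So the
    matrices of the products in the two orders are proportional, and if the products differed this
    would be a linear relation, with coefficients \<open>a\<close>.\<close>
  have comm: "x \<otimes>\<^bsub>G\<^esub> y = y \<otimes>\<^bsub>G\<^esub> x" if xy: "x \<in> N" "y \<in> N" for x y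
  proof (rule ccontr)
    assume ne: "x \<otimes>\<^bsub>G\<^esub> y \<noteq> y \<otimes>\<^bsub>G\<^esub> x"
    define a where "a z = (if z = x \<otimes>\<^bsub>G\<^esub> y then \<alpha> x y else if z = y \<otimes>\<^bsub>G\<^esub> x then - \<alpha> y x else 0)" for z
    have "(\<Sum>z\<in>N. a z * v z c) = 0" if c: "c \<in> carrier H" for c
    proof -
      have "(\<Sum>z\<in>N. a z * v z c) = (\<Sum>z\<in>{x \<otimes>\<^bsub>G\<^esub> y, y \<otimes>\<^bsub>G\<^esub> x}. a z * v z c)"
        using finN xy by (intro sum.mono_neutral_right) (auto simp: a_def)
      also have "\<dots> = 0" using ne multN[OF xy c] multN[OF xy(2,1) c] by (simp add: a_def mult.commute)
      finally show ?thesis .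
    qed
    from indep[OF this, of "x \<otimes>\<^bsub>G\<^esub> y"] show False using xy \<alpha>0[of x y] by (simp add: a_def Nc)
  qed
  \<comment> \<open>For fixed \<open>b\<close> the entry \<open>v x b\<close> is multiplicative in
    \<open>x\<close> only up to \<open>\<alpha>\<close>, which does not involve \<open>b\<close>.
    Dividing by the entry at the unit cancels it.\<close>
  define \<delta> where "\<delta> b = (\<lambda>x\<in>N. v x b / v x \<one>\<^bsub>H\<^esub>)" for b
  define lift where "lift = inv_into (carrier G) \<phi>"
  have lift: "lift b \<in> carrier G" "\<phi> (lift b) = b" if "b \<in> carrier H" for b
    using that surj by (auto simp: lift_def inv_into_into f_inv_into_f)
  \<comment> \<open>With the inverse on the left this is a right action of \<open>G\<close>
    (\<open>conj_conj\<close>), so precomposing characters with it gives a left action.\<close>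
  define conj where "conj g y = inv\<^bsub>G\<^esub> g \<otimes>\<^bsub>G\<^esub> y \<otimes>\<^bsub>G\<^esub> g" for g y
  have conj_N: "conj g y \<in> N" if "g \<in> carrier G" "y \<in> N" for g y
    using normal.inv_op_closed1[OF nN that] by (simp add: conj_def)
  have conj_conj: "conj g' (conj g y) = conj (g \<otimes>\<^bsub>G\<^esub> g') y"
    if "g \<in> carrier G" "g' \<in> carrier G" "y \<in> carrier G" for g g' y
    using that by (simp add: conj_def G.inv_mult_group G.m_assoc)
  have conj_trivial: "conj z y = y" if "z \<in> N" "y \<in> N" for z y
  proof -
    have "conj z y = inv\<^bsub>G\<^esub> z \<otimes>\<^bsub>G\<^esub> (z \<otimes>\<^bsub>G\<^esub> y)" using that comm[of y z] by (simp add: conj_def Nc G.m_assoc)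
    then show ?thesis using that by (simp add: Nc flip: G.m_assoc)
  qed
  \<comment> \<open>Since \<open>N\<close> is abelian, conjugation on it depends only on the image
    under \<open>\<phi>\<close>; hence the arbitrary choices in \<open>lift\<close> are
    harmless.\<close>
  have conj_eq: "conj g y = conj g' y"
    if g: "g \<in> carrier G" "g' \<in> carrier G" "\<phi> g = \<phi> g'" and y: "y \<in> N" for g g' y
  proof -
    have "inv\<^bsub>G\<^esub> g' \<otimes>\<^bsub>G\<^esub> g \<in> N" using g by (intro NI) auto
    then have "conj (inv\<^bsub>G\<^esub> g' \<otimes>\<^bsub>G\<^esub> g) (conj g' y) = conj g' y"
      using g y conj_N by (intro conj_trivial) auto
    then show ?thesis using g y by (simp add: conj_conj Nc flip: G.m_assoc)
  qed
  \<comment> \<open>The value \<open>undefined\<close> off the dual makes \<open>act b\<close>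
    extensional, as \<open>AutoGroup\<close> demands.\<close>
  define act where "act b \<chi> = (if \<chi> \<in> carrier (dual_group ?N) then \<lambda>y\<in>N. \<chi> (conj (lift b) y) else undefined)"
    for b :: 'a and \<chi> :: "'g \<Rightarrow> complex"
  let ?D = "dual_group ?N"
  interpret D: comm_group ?D by (rule NG.comm_group_dual)
  have act_char: "act b \<chi> \<in> carrier ?D" if "b \<in> carrier H" "\<chi> \<in> carrier ?D" for b \<chi>
  proof -
    have "conj g (x \<otimes>\<^bsub>G\<^esub> y) = conj g x \<otimes>\<^bsub>G\<^esub> conj g y" if "g \<in> carrier G" "x \<in> N" "y \<in> N" for g x y
    proof -
      have "g \<otimes>\<^bsub>G\<^esub> (inv\<^bsub>G\<^esub> g \<otimes>\<^bsub>G\<^esub> (y \<otimes>\<^bsub>G\<^esub> g)) = y \<otimes>\<^bsub>G\<^esub> g"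
        using that by (simp add: Nc flip: G.m_assoc)
      then show ?thesis using that by (simp add: conj_def Nc G.m_assoc)
    qed
    then show ?thesis using that conj_N lift by (auto simp: act_def character_def)
  qed
  have "act \<in> hom H (AutoGroup ?D)"
  proof (rule hom_AutoGroupI[OF H])
    fix b assume b: "b \<in> carrier H"
    show "act b \<in> extensional (carrier ?D)" by (auto simp: act_def extensional_def)
    show "act b \<in> hom ?D ?D"
    proof (rule homI)
      fix \<chi> \<xi> assume \<chi>: "\<chi> \<in> carrier ?D" and \<xi>: "\<xi> \<in> carrier ?D"
      have "\<chi> \<otimes>\<^bsub>?D\<^esub> \<xi> \<in> carrier ?D" using \<chi> \<xi> by (rule D.m_closed)
      then show "act b (\<chi> \<otimes>\<^bsub>?D\<^esub> \<xi>) = act b \<chi> \<otimes>\<^bsub>?D\<^esub> act b \<xi>"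
        using \<chi> \<xi> b conj_N lift unfolding act_def by (auto simp del: dual_group_simps(1) intro!: ext)
    qed (rule act_char[OF b])
  next
    fix b c \<chi> assume b: "b \<in> carrier H" and c: "c \<in> carrier H" and \<chi>: "\<chi> \<in> carrier ?D"
    have "conj (lift (b \<otimes>\<^bsub>H\<^esub> c)) y = conj (lift c) (conj (lift b) y)" if "y \<in> N" for y
      using b c that lift by (simp add: conj_conj Nc, intro conj_eq) simp_all
    then show "act (b \<otimes>\<^bsub>H\<^esub> c) \<chi> = act b (act c \<chi>)"
      using act_char[OF c \<chi>] b c \<chi> conj_N lift unfolding act_def by (auto simp del: dual_group_simps(1) intro!: ext)
  next
    fix \<chi> assume \<chi>: "\<chi> \<in> carrier ?D"
    have "conj (lift \<one>\<^bsub>H\<^esub>) y = y" if "y \<in> N" for y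
      using lift by (intro conj_trivial NI that) auto
    then show "act \<one>\<^bsub>H\<^esub> \<chi> = \<chi>"
      using \<chi> by (auto simp: act_def extensional_def)
  qed
  moreover have \<delta>D: "\<delta> b \<in> carrier ?D" if b: "b \<in> carrier H" for b
  proof -
    have "v (x \<otimes>\<^bsub>G\<^esub> y) b / v (x \<otimes>\<^bsub>G\<^esub> y) \<one>\<^bsub>H\<^esub> = v x b / v x \<one>\<^bsub>H\<^esub> * (v y b / v y \<one>\<^bsub>H\<^esub>)"
      if "x \<in> N" "y \<in> N" for x y
    proof -
      have "v x b * v y b / (v x \<one>\<^bsub>H\<^esub> * v y \<one>\<^bsub>H\<^esub>) = v (x \<otimes>\<^bsub>G\<^esub> y) b / v (x \<otimes>\<^bsub>G\<^esub> y) \<one>\<^bsub>H\<^esub>"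
        using that b \<alpha>0[of x y] by (simp add: multN Nc)
      then show ?thesis by simp
    qed
    then show ?thesis using b by (auto simp: \<delta>_def character_def nz Nc)
  qed
  moreover have "bij_betw \<delta> (carrier H) (carrier ?D)"
    unfolding bij_betw_def
  proof (intro conjI equalityI subsetI)
    show "inj_on \<delta> (carrier H)"
    proof (rule inj_onI, rule ccontr)
      fix b c assume b: "b \<in> carrier H" and c: "c \<in> carrier H" and eq: "\<delta> b = \<delta> c" and ne: "b \<noteq> c"
      obtain x where x: "x \<in> N" "v x b \<noteq> v x c" using sep[OF b c ne] by blast
      have "\<delta> b x = \<delta> c x" by (simp add: eq)
      then show False using x nz[of x "\<one>\<^bsub>H\<^esub>"] by (simp add: \<delta>_def Nc)
    qed
  next
    show "\<chi> \<in> carrier ?D" if "\<chi> \<in> \<delta> ` carrier H" for \<chi> using that \<delta>D by blast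
  next
    fix \<chi> assume \<chi>: "\<chi> \<in> carrier ?D"
    show "\<chi> \<in> \<delta> ` carrier H"
    proof (rule ccontr)
      assume no: "\<chi> \<notin> \<delta> ` carrier H"
      \<comment> \<open>Orthogonality of \<open>\<chi>\<close> to every \<open>\<delta> c\<close>
        becomes a linear relation among the diagonal matrices whose coefficient at the unit is
        nonzero. This yields surjectivity without comparing orders.\<close>
      have "(\<Sum>x\<in>N. inverse (\<chi> x * v x \<one>\<^bsub>H\<^esub>) * v x c) = 0" if c: "c \<in> carrier H" for c
      proof -
        have "(\<Sum>x\<in>N. inverse (\<chi> x * v x \<one>\<^bsub>H\<^esub>) * v x c) = (\<Sum>x\<in>carrier ?N. \<delta> c x * inverse (\<chi> x))"
          by (auto simp: \<delta>_def field_simps intro!: sum.cong)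
        also have "\<dots> = 0"
          using NG.character_orthogonality[OF \<delta>D[OF c] \<chi>] no c by auto
        finally show ?thesis .
      qed
      from indep[OF this N.one_closed] show False
        using \<chi> nz[of "\<one>\<^bsub>G\<^esub>" "\<one>\<^bsub>H\<^esub>"] by (auto simp: character_def)
    qed
  qed
  moreover have "\<delta> (b \<otimes>\<^bsub>H\<^esub> c) = \<delta> b \<otimes>\<^bsub>?D\<^esub> act b (\<delta> c)" if b: "b \<in> carrier H" and c: "c \<in> carrier H" for b c
  proof -
    have "v y (b \<otimes>\<^bsub>H\<^esub> c) / v y \<one>\<^bsub>H\<^esub> = v y b / v y \<one>\<^bsub>H\<^esub> * (v x c / v x \<one>\<^bsub>H\<^esub>)"
      if y: "y \<in> N" and x: "x = conj (lift b) y" for x y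
    proof -
      let ?g = "lift b"
      have g: "?g \<in> carrier G" "\<phi> ?g = b" using lift b by auto
      have xN: "x \<in> N" using conj_N g y x by simp
      have gx: "?g \<otimes>\<^bsub>G\<^esub> x = y \<otimes>\<^bsub>G\<^esub> ?g" using g y by (simp add: x conj_def Nc flip: G.m_assoc)
      \<comment> \<open>Column \<open>d\<close> of the matrix of \<open>y \<otimes> ?g\<close>,
        which equals \<open>?g \<otimes> x\<close>, computed in two ways. The factors from
        \<open>\<alpha>\<close> do not involve \<open>d\<close>, so they cancel when the instances
        at \<open>c\<close> and at the unit are divided.\<close>
      have key: "v y (b \<otimes>\<^bsub>H\<^esub> d) * \<alpha> ?g x = v x d * \<alpha> y ?g" if d: "d \<in> carrier H" for d
      proof -
        have 1: "v y (b \<otimes>\<^bsub>H\<^esub> d) * v ?g d = \<alpha> y ?g * v (y \<otimes>\<^bsub>G\<^esub> ?g) d"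
          using mult[of y ?g d] g y d by (simp add: Nc)
        have 2: "v ?g d * v x d = \<alpha> ?g x * v (y \<otimes>\<^bsub>G\<^esub> ?g) d"
          using mult[of ?g x d] g xN d by (simp add: Nc N\<phi> gx)
        have "v ?g d * (v y (b \<otimes>\<^bsub>H\<^esub> d) * \<alpha> ?g x) = \<alpha> y ?g * (\<alpha> ?g x * v (y \<otimes>\<^bsub>G\<^esub> ?g) d)"
          using arg_cong[OF 1, of "\<lambda>z. z * \<alpha> ?g x"] by (simp only: ac_simps)
        also have "\<dots> = v ?g d * (v x d * \<alpha> y ?g)"
          unfolding 2[symmetric] by (simp only: ac_simps)
        finally have "v ?g d * (v y (b \<otimes>\<^bsub>H\<^esub> d) * \<alpha> ?g x) = v ?g d * (v x d * \<alpha> y ?g)" .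
        then show ?thesis using nz[OF g(1) d] by simp
      qed
      have "v y (b \<otimes>\<^bsub>H\<^esub> c) / v y b = (v y (b \<otimes>\<^bsub>H\<^esub> c) * \<alpha> ?g x) / (v y (b \<otimes>\<^bsub>H\<^esub> \<one>\<^bsub>H\<^esub>) * \<alpha> ?g x)"
        using \<alpha>0[of ?g x] g xN b by (simp add: Nc)
      also have "\<dots> = (v x c * \<alpha> y ?g) / (v x \<one>\<^bsub>H\<^esub> * \<alpha> y ?g)"
        by (simp only: key[OF c] key[OF H.one_closed])
      also have "\<dots> = v x c / v x \<one>\<^bsub>H\<^esub>"
        using \<alpha>0[of y ?g] g y by (simp add: Nc)
      finally have "v x c / v x \<one>\<^bsub>H\<^esub> = v y (b \<otimes>\<^bsub>H\<^esub> c) / v y b" ..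
      then show ?thesis using nz[of y b] b y by (simp add: Nc)
    qed
    then show ?thesis
      using \<delta>D[OF c] b conj_N lift by (auto simp: act_def \<delta>_def fun_eq_iff)
  qed
  ultimately have "bijective_cocycle H ?D act \<delta>"
    using D.comm_group_axioms unfolding bijective_cocycle_def by blast
  then show ?thesis by (rule IYB_I[OF H finH])
qed

text \<open>The image of the basis element of \<open>g\<close> is homogeneous of degree
  \<open>\<phi> g\<close>, hence monomial with support given by left translation. Independence over
  the kernel comes from injectivity of \<open>\<psi>\<close>, separation of indices from its
  surjectivity.\<close>

lemma IYB_of_quotient_morphism:
  fixes G :: "'g monoid" and H :: "'a monoid"
  assumes G: "group G" and finG: "finite (carrier G)" and \<alpha>: "two_cocycle G \<alpha>"
    and H: "group H" and finH: "finite (carrier H)" and h: "bij_betw h {..<n} (carrier H)"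
    and q: "quotient_morphism (twisted_grading G \<alpha>) (elementary_crossed_product H n h) \<psi> \<phi>"
  shows "IYB H"
proof -
  interpret G: group G by (rule G)
  interpret H: group H by (rule H)
  let ?A = "twisted_group_algebra G \<alpha>" and ?M = "matrix_algebra n"
  interpret A: complex_algebra ?A by (rule complex_algebra_twisted[OF G finG \<alpha>])
  have iso: "\<psi> \<in> algebra_iso ?A ?M" and \<phi>: "\<phi> \<in> epi G H"
    using q by (simp_all add: quotient_morphism_def twisted_grading_def elementary_crossed_product_def)
  have deg: "\<psi> x \<in> cmp (elementary_crossed_product H n h) (\<phi> g)"
    if "g \<in> carrier G" "x \<in> cmp (twisted_grading G \<alpha>) g" for g x
    using q that by (fastforce simp: quotient_morphism_def twisted_grading_def)
  have \<psi>bij: "bij_betw \<psi> (carrier ?A) (carrier ?M)"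
    and \<psi>mult: "\<And>x y. x \<in> carrier ?A \<Longrightarrow> y \<in> carrier ?A \<Longrightarrow> \<psi> (x \<otimes>\<^bsub>?A\<^esub> y) = \<psi> x * \<psi> y"
    and \<psi>add: "\<And>x y. x \<in> carrier ?A \<Longrightarrow> y \<in> carrier ?A \<Longrightarrow> \<psi> (x \<oplus>\<^bsub>?A\<^esub> y) = \<psi> x + \<psi> y"
    and \<psi>one: "\<psi> \<one>\<^bsub>?A\<^esub> = 1\<^sub>m n"
    and \<psi>smult: "\<And>c x. x \<in> carrier ?A \<Longrightarrow> \<psi> (c \<odot>\<^bsub>?A\<^esub> x) = c \<cdot>\<^sub>m \<psi> x"
    using iso by (auto simp: algebra_iso_def ring_iso_def Ring.ring_hom_def module_mat_def bij_betw_def)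
  have \<psi>c: "\<psi> x \<in> carrier_mat n n" if "x \<in> carrier ?A" for x
    using \<psi>bij that by (auto simp: bij_betw_def module_mat_def)
  have Ac: "x \<in> carrier ?A \<longleftrightarrow> (\<forall>g. g \<notin> carrier G \<longrightarrow> x g = 0)" for x
    by (simp add: twisted_group_algebra_def)
  define u where "u g = (\<lambda>k. if k = g then 1 else 0 :: complex)" for g :: 'g
  define U where "U g = \<psi> (u g)" for g
  have uA: "u g \<in> carrier ?A" if "g \<in> carrier G" for g using that by (auto simp: Ac u_def)
  have Uc: "U g \<in> carrier_mat n n" if "g \<in> carrier G" for g
    unfolding U_def by (rule \<psi>c[OF uA[OF that]])
  have \<psi>zero: "\<psi> (\<lambda>k. 0) = 0\<^sub>m n n"
  proof -
    have z: "(\<lambda>k. 0) \<in> carrier ?A" by (simp add: Ac)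
    have "(\<lambda>k. 0) = 0 \<odot>\<^bsub>?A\<^esub> (\<lambda>k. 0)" by (simp add: twisted_group_algebra_def)
    then have "\<psi> (\<lambda>k. 0) = 0 \<cdot>\<^sub>m \<psi> (\<lambda>k. 0)" using \<psi>smult[OF z, of 0] by simp
    also have "\<dots> = 0\<^sub>m n n" using \<psi>c[OF z] by auto
    finally show ?thesis .
  qed
  \<comment> \<open>Stated for a subset \<open>S\<close> because it serves both for the whole group
    and for the kernel of \<open>\<phi>\<close>.\<close>
  have expand_on: "\<psi> (\<lambda>k. if k \<in> S then x k else 0) $$ (i, j) = (\<Sum>g\<in>S. x g * U g $$ (i, j))"
    if S: "S \<subseteq> carrier G" and ij: "i < n" "j < n" for S x i j
    using finite_subset[OF S finG] S
  proof (induction rule: finite_induct)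
    case empty
    then show ?case using ij by (simp add: \<psi>zero)
  next
    case (insert g S)
    have g: "g \<in> carrier G" and c: "(\<lambda>k. if k \<in> S then x k else 0) \<in> carrier ?A"
      using insert.prems by (auto simp: Ac)
    have su: "x g \<odot>\<^bsub>?A\<^esub> u g \<in> carrier ?A" using uA[OF g] by simp
    have "(\<lambda>k. if k \<in> insert g S then x k else 0) = x g \<odot>\<^bsub>?A\<^esub> u g \<oplus>\<^bsub>?A\<^esub> (\<lambda>k. if k \<in> S then x k else 0)"
      using insert.hyps by (auto simp: twisted_group_algebra_def u_def)
    then have "\<psi> (\<lambda>k. if k \<in> insert g S then x k else 0) = x g \<cdot>\<^sub>m U g + \<psi> (\<lambda>k. if k \<in> S then x k else 0)"
      using \<psi>add[OF su c] uA[OF g] by (simp add: \<psi>smult U_def)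
    then show ?case using insert Uc[OF g] \<psi>c[OF c] ij by simp
  qed
  have expand: "\<psi> x $$ (i, j) = (\<Sum>g\<in>carrier G. x g * U g $$ (i, j))"
    if x: "x \<in> carrier ?A" and ij: "i < n" "j < n" for x i j
  proof -
    have "x = (\<lambda>k. if k \<in> carrier G then x k else 0)" using x by (auto simp: Ac)
    then show ?thesis using expand_on[OF subset_refl ij, of x] by simp
  qed
  have Umult: "U g * U g' = \<alpha> g g' \<cdot>\<^sub>m U (g \<otimes>\<^bsub>G\<^esub> g')" if g: "g \<in> carrier G" "g' \<in> carrier G" for g g'
  proof -
    have "(u g \<otimes>\<^bsub>?A\<^esub> u g') k = (\<alpha> g g' \<odot>\<^bsub>?A\<^esub> u (g \<otimes>\<^bsub>G\<^esub> g')) k" for k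
    proof -
      have "(u g \<otimes>\<^bsub>?A\<^esub> u g') k = (\<Sum>a\<in>carrier G. \<Sum>b\<in>carrier G. if a = g then
          (if b = g' then (if g \<otimes>\<^bsub>G\<^esub> g' = k then \<alpha> g g' else 0) else 0) else 0)"
        unfolding twisted_group_algebra_def u_def by (auto intro!: sum.cong)
      also have "\<dots> = (\<Sum>a\<in>carrier G. if a = g then (\<Sum>b\<in>carrier G.
          if b = g' then (if g \<otimes>\<^bsub>G\<^esub> g' = k then \<alpha> g g' else 0) else 0) else 0)"
        by (intro sum.cong) auto
      also have "\<dots> = (if g \<otimes>\<^bsub>G\<^esub> g' = k then \<alpha> g g' else 0)"
        using finG g by simp
      finally show ?thesis by (auto simp: twisted_group_algebra_def u_def)
    qed
    then have "u g \<otimes>\<^bsub>?A\<^esub> u g' = \<alpha> g g' \<odot>\<^bsub>?A\<^esub> u (g \<otimes>\<^bsub>G\<^esub> g')" by (rule ext)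
    then show ?thesis
      unfolding U_def using \<psi>mult[of "u g" "u g'"] uA g by (simp add: \<psi>smult)
  qed
  have Udeg: "h i = \<phi> g \<otimes>\<^bsub>H\<^esub> h j"
    if g: "g \<in> carrier G" and ij: "i < n" "j < n" and ne: "U g $$ (i, j) \<noteq> 0" for g i j
  proof -
    have hc: "h i \<in> carrier H" "h j \<in> carrier H" using h ij by (auto simp: bij_betw_def)
    have "U g \<in> cmp (elementary_crossed_product H n h) (\<phi> g)"
      unfolding U_def using g by (intro deg) (auto simp: twisted_grading_def u_def)
    then have "h i \<otimes>\<^bsub>H\<^esub> inv\<^bsub>H\<^esub> (h j) = \<phi> g" using ij ne by (auto simp: elementary_crossed_product_def)
    then have "\<phi> g \<otimes>\<^bsub>H\<^esub> h j = h i \<otimes>\<^bsub>H\<^esub> inv\<^bsub>H\<^esub> (h j) \<otimes>\<^bsub>H\<^esub> h j" by simp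
    then show ?thesis using hc by (simp add: H.m_assoc)
  qed
  define \<kappa> where "\<kappa> = inv_into {..<n} h"
  have \<kappa>: "\<kappa> a < n" "h (\<kappa> a) = a" if "a \<in> carrier H" for a
    using h that inv_into_into[of a h "{..<n}"] by (auto simp: \<kappa>_def bij_betw_def f_inv_into_f)
  have \<kappa>h: "\<kappa> (h i) = i" "h i \<in> carrier H" if "i < n" for i
    using h that by (auto simp: \<kappa>_def bij_betw_def)
  have \<phi>c: "\<phi> g \<in> carrier H" if "g \<in> carrier G" for g using \<phi> that by (auto simp: epi_def)
  define v where "v g c = U g $$ (\<kappa> (\<phi> g \<otimes>\<^bsub>H\<^esub> c), \<kappa> c)" for g c
  have mult: "v g (\<phi> g' \<otimes>\<^bsub>H\<^esub> c) * v g' c = \<alpha> g g' * v (g \<otimes>\<^bsub>G\<^esub> g') c"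
    if g: "g \<in> carrier G" "g' \<in> carrier G" and c: "c \<in> carrier H" for g g' c
  proof -
    let ?i = "\<kappa> (\<phi> g \<otimes>\<^bsub>H\<^esub> (\<phi> g' \<otimes>\<^bsub>H\<^esub> c))" and ?k = "\<kappa> (\<phi> g' \<otimes>\<^bsub>H\<^esub> c)"
    have \<phi>m: "\<phi> (g \<otimes>\<^bsub>G\<^esub> g') = \<phi> g \<otimes>\<^bsub>H\<^esub> \<phi> g'" using \<phi> g by (auto simp: epi_def hom_def)
    have lt: "?i < n" "?k < n" "\<kappa> c < n" using \<kappa>(1) g c \<phi>c by auto
    have "(U g * U g') $$ (?i, \<kappa> c) = (\<Sum>k<n. U g $$ (?i, k) * U g' $$ (k, \<kappa> c))"
      using Uc[OF g(1)] Uc[OF g(2)] lt by (simp add: scalar_prod_def atLeast0LessThan)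
    \<comment> \<open>By \<open>Udeg\<close>, column \<open>\<kappa> c\<close> of
      \<open>U g'\<close> vanishes outside row \<open>?k\<close>.\<close>
    also have "\<dots> = (\<Sum>k<n. if k = ?k then U g $$ (?i, ?k) * U g' $$ (?k, \<kappa> c) else 0)"
    proof (rule sum.cong[OF refl])
      fix k assume k: "k \<in> {..<n}"
      have "k = ?k" if "U g' $$ (k, \<kappa> c) \<noteq> 0"
        using Udeg[OF g(2) _ lt(3) that] k \<kappa>(2)[OF c] \<kappa>h(1)[of k] by simp
      then show "U g $$ (?i, k) * U g' $$ (k, \<kappa> c) = (if k = ?k then U g $$ (?i, ?k) * U g' $$ (?k, \<kappa> c) else 0)"
        by auto
    qed
    also have "\<dots> = v g (\<phi> g' \<otimes>\<^bsub>H\<^esub> c) * v g' c" using lt by (simp add: v_def)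
    finally show ?thesis
      using lt Uc[of "g \<otimes>\<^bsub>G\<^esub> g'"] g c \<phi>c by (simp add: Umult v_def \<phi>m H.m_assoc)
  qed
  have \<alpha>0: "\<alpha> g g' \<noteq> 0" if "g \<in> carrier G" "g' \<in> carrier G" for g g'
    using \<alpha> that by (simp add: two_cocycle_def)
  have \<phi>1: "\<phi> \<one>\<^bsub>G\<^esub> = \<one>\<^bsub>H\<^esub>" using \<phi> hom_one[OF _ G H, of \<phi>] by (simp add: epi_def)
  have v1: "v \<one>\<^bsub>G\<^esub> c \<noteq> 0" if c: "c \<in> carrier H" for c
  proof -
    have "\<one>\<^bsub>?A\<^esub> = inverse (\<alpha> \<one>\<^bsub>G\<^esub> \<one>\<^bsub>G\<^esub>) \<odot>\<^bsub>?A\<^esub> u \<one>\<^bsub>G\<^esub>"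
      by (auto simp: twisted_group_algebra_def u_def)
    then have "1\<^sub>m n = inverse (\<alpha> \<one>\<^bsub>G\<^esub> \<one>\<^bsub>G\<^esub>) \<cdot>\<^sub>m U \<one>\<^bsub>G\<^esub>"
      using \<psi>one \<psi>smult[OF uA[OF G.one_closed]] by (simp add: U_def)
    then have "1\<^sub>m n $$ (\<kappa> c, \<kappa> c) = inverse (\<alpha> \<one>\<^bsub>G\<^esub> \<one>\<^bsub>G\<^esub>) * U \<one>\<^bsub>G\<^esub> $$ (\<kappa> c, \<kappa> c)"
      using \<kappa>(1)[OF c] Uc[OF G.one_closed] by simp
    then show ?thesis using c \<kappa>(1)[OF c] by (auto simp: v_def \<phi>1)
  qed
  \<comment> \<open>A zero of \<open>v g c\<close> would, on multiplying by the matrix of the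
    inverse of \<open>g\<close>, give a zero on the diagonal of the matrix of the unit, against
    \<open>v1\<close>.\<close>
  have nz: "v g c \<noteq> 0" if g: "g \<in> carrier G" and c: "c \<in> carrier H" for g c
    using mult[of "inv\<^bsub>G\<^esub> g" g c] v1[OF c] \<alpha>0[of "inv\<^bsub>G\<^esub> g" g] g c by auto
  have ker: "\<kappa> (\<phi> x \<otimes>\<^bsub>H\<^esub> c) = \<kappa> c" if "x \<in> kernel G H \<phi>" "c \<in> carrier H" for x c
    using that by (simp add: kernel_def)
  have kerG: "kernel G H \<phi> \<subseteq> carrier G" by (auto simp: kernel_def)
  show ?thesis
  proof (rule IYB_of_monomial_representation[OF G finG H finH \<phi> mult nz])
    fix a x
    assume a: "\<And>c. c \<in> carrier H \<Longrightarrow> (\<Sum>x\<in>kernel G H \<phi>. a x * v x c) = 0" and x: "x \<in> kernel G H \<phi>"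
    \<comment> \<open>Extension by zero to an element of the algebra. Its image is diagonal, and the
      assumed relation kills the diagonal entries, so \<open>a'\<close> is zero by
      injectivity.\<close>
    define a' where "a' k = (if k \<in> kernel G H \<phi> then a k else 0)" for k
    have a'c: "a' \<in> carrier ?A" using kerG by (auto simp: a'_def Ac)
    have "\<psi> a' $$ (i, j) = 0" if ij: "i < n" "j < n" for i j
    proof -
      have "\<psi> a' $$ (i, j) = (\<Sum>x\<in>kernel G H \<phi>. a x * U x $$ (i, j))"
        using expand_on[OF kerG ij, of a] by (simp add: a'_def[abs_def])
      also have "\<dots> = 0"
      proof (cases "i = j")
        case True
        have "(\<Sum>x\<in>kernel G H \<phi>. a x * U x $$ (i, j)) = (\<Sum>x\<in>kernel G H \<phi>. a x * v x (h i))"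
          using ij \<kappa>h by (intro sum.cong) (simp_all add: v_def ker True)
        then show ?thesis using a \<kappa>h ij by simp
      next
        case False
        have "U x $$ (i, j) = 0" if "x \<in> kernel G H \<phi>" for x
        proof (rule ccontr)
          assume "U x $$ (i, j) \<noteq> 0"
          then have "h i = h j" using Udeg[OF _ ij, of x] that \<kappa>h ij by (auto simp: kernel_def)
          then show False using False \<kappa>h ij by metis
        qed
        then show ?thesis by simp
      qed
      finally show ?thesis .
    qed
    then have "\<psi> a' = \<psi> (\<lambda>k. 0)" using \<psi>c[OF a'c] by (auto simp: \<psi>zero)
    then have "a' = (\<lambda>k. 0)" using \<psi>bij a'c by (auto simp: bij_betw_def inj_on_def Ac)
    then show "a x = 0" using x by (metis a'_def)
  next
    fix b c assume b: "b \<in> carrier H" and c: "c \<in> carrier H" and "b \<noteq> c"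
    then have ne: "\<kappa> b \<noteq> \<kappa> c" by (metis \<kappa>(2))
    \<comment> \<open>A diagonal matrix unit that tells \<open>b\<close> from \<open>c\<close>. Only
      kernel elements contribute to its diagonal (\<open>diag\<close>), so one of them must already
      tell \<open>b\<close> from \<open>c\<close>.\<close>
    define E where "E = mat n n (\<lambda>(i, j). if i = \<kappa> b \<and> j = \<kappa> b then 1 else 0 :: complex)"
    have "E \<in> carrier ?M" by (simp add: E_def module_mat_def)
    then obtain x where x: "x \<in> carrier ?A" "E = \<psi> x" using \<psi>bij by (auto simp: bij_betw_def)
    have diag: "E $$ (\<kappa> d, \<kappa> d) = (\<Sum>g\<in>kernel G H \<phi>. x g * v g d)" if d: "d \<in> carrier H" for d
    proof -
      have "U g $$ (\<kappa> d, \<kappa> d) = 0" if g: "g \<in> carrier G - kernel G H \<phi>" for g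
      proof (rule ccontr)
        assume "U g $$ (\<kappa> d, \<kappa> d) \<noteq> 0"
        then have "h (\<kappa> d) = \<phi> g \<otimes>\<^bsub>H\<^esub> h (\<kappa> d)" using Udeg[of g "\<kappa> d" "\<kappa> d"] g \<kappa>(1)[OF d] by blast
        then have "\<one>\<^bsub>H\<^esub> \<otimes>\<^bsub>H\<^esub> d = \<phi> g \<otimes>\<^bsub>H\<^esub> d" using d by (simp only: \<kappa>(2) H.l_one)
        then have "\<phi> g = \<one>\<^bsub>H\<^esub>" using d g \<phi>c[of g] H.right_cancel[of d "\<one>\<^bsub>H\<^esub>" "\<phi> g"] by simp
        then show False using g by (simp add: kernel_def)
      qed
      then have "E $$ (\<kappa> d, \<kappa> d) = (\<Sum>g\<in>kernel G H \<phi>. x g * U g $$ (\<kappa> d, \<kappa> d))"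
        unfolding x(2) expand[OF x(1) \<kappa>(1)[OF d] \<kappa>(1)[OF d]]
        using finG kerG by (intro sum.mono_neutral_right) auto
      then show ?thesis using d by (simp add: v_def ker)
    qed
    have "E $$ (\<kappa> b, \<kappa> b) \<noteq> E $$ (\<kappa> c, \<kappa> c)" using \<kappa>(1) b c ne by (simp add: E_def)
    then show "\<exists>x\<in>kernel G H \<phi>. v x b \<noteq> v x c"
      unfolding diag[OF b] diag[OF c] by (metis (mono_tags, lifting) sum.cong)
  qed
qed

subsection \<open>From a bijective cocycle to a quotient morphism\<close>

text \<open>\<open>U g\<close> is the image of the basis element of \<open>g\<close> and
  \<open>V\<close> encodes the inverse map: \<open>UV\<close> gives injectivity and
  \<open>VU\<close> surjectivity. The factor in \<open>one\<close> is there because the unit of the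
  algebra is a basis element divided by it.\<close>

lemma twisted_algebra_iso_matrixI:
  fixes U V :: "'g \<Rightarrow> nat \<Rightarrow> nat \<Rightarrow> complex"
  assumes G: "group G" and fin: "finite (carrier G)" and \<alpha>: "two_cocycle G \<alpha>"
    and one: "\<And>i j. \<lbrakk>i < n; j < n\<rbrakk> \<Longrightarrow> U \<one>\<^bsub>G\<^esub> i j = (if i = j then \<alpha> \<one>\<^bsub>G\<^esub> \<one>\<^bsub>G\<^esub> else 0)"
    and mult: "\<And>g g' i j. \<lbrakk>g \<in> carrier G; g' \<in> carrier G; i < n; j < n\<rbrakk>
      \<Longrightarrow> (\<Sum>k<n. U g i k * U g' k j) = \<alpha> g g' * U (g \<otimes>\<^bsub>G\<^esub> g') i j"
    and UV: "\<And>g g'. \<lbrakk>g \<in> carrier G; g' \<in> carrier G\<rbrakk>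
      \<Longrightarrow> (\<Sum>i<n. \<Sum>j<n. U g i j * V g' i j) = (if g = g' then 1 else 0)"
    and VU: "\<And>i j i' j'. \<lbrakk>i < n; j < n; i' < n; j' < n\<rbrakk>
      \<Longrightarrow> (\<Sum>g\<in>carrier G. U g i j * V g i' j') = (if i = i' \<and> j = j' then 1 else 0)"
  shows "(\<lambda>x. mat n n (\<lambda>(i, j). \<Sum>g\<in>carrier G. x g * U g i j))
    \<in> algebra_iso (twisted_group_algebra G \<alpha>) (matrix_algebra n)"
proof -
  interpret G: group G by (rule G)
  let ?A = "twisted_group_algebra G \<alpha>" and ?M = "matrix_algebra n" and ?S = "carrier G"
  define F where "F x = mat n n (\<lambda>(i, j). \<Sum>g\<in>?S. x g * U g i j)" for x
  define F' where "F' X = (\<lambda>g. if g \<in> ?S then \<Sum>i<n. \<Sum>j<n. X $$ (i, j) * V g i j else 0)" for X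
  have F: "F x \<in> carrier_mat n n" for x by (simp add: F_def)
  have Fij: "F x $$ (i, j) = (\<Sum>g\<in>?S. x g * U g i j)" if "i < n" "j < n" for x i j
    using that by (simp add: F_def)
  have F'F: "F' (F x) g = x g" if g: "g \<in> ?S" for x g
  proof -
    have "F' (F x) g = (\<Sum>i<n. \<Sum>j<n. \<Sum>g'\<in>?S. x g' * (U g' i j * V g i j))"
      using g by (simp add: F'_def Fij sum_distrib_right mult.assoc)
    also have "\<dots> = (\<Sum>g'\<in>?S. \<Sum>i<n. \<Sum>j<n. x g' * (U g' i j * V g i j))"
      by (rule trans[OF sum.cong[OF refl sum.swap] sum.swap])
    also have "\<dots> = (\<Sum>g'\<in>?S. x g' * (if g' = g then 1 else 0))"
      using g by (intro sum.cong refl) (simp add: UV flip: sum_distrib_left)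
    finally show ?thesis using fin g by (simp add: if_distrib cong: if_cong)
  qed
  have FF': "F (F' X) = X" if X: "X \<in> carrier_mat n n" for X
  proof (rule eq_matI)
    fix i j assume "i < dim_row X" "j < dim_col X"
    then have ij: "i < n" "j < n" using X by auto
    have "F (F' X) $$ (i, j) = (\<Sum>g\<in>?S. \<Sum>i'<n. \<Sum>j'<n. X $$ (i', j') * (U g i j * V g i' j'))"
      using ij by (simp add: Fij F'_def sum_distrib_left mult_ac)
    also have "\<dots> = (\<Sum>i'<n. \<Sum>j'<n. \<Sum>g\<in>?S. X $$ (i', j') * (U g i j * V g i' j'))"
      by (rule trans[OF sum.swap sum.cong[OF refl sum.swap]])
    also have "\<dots> = (\<Sum>i'<n. \<Sum>j'<n. if j' = j then (if i' = i then X $$ (i, j) else 0) else 0)"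
      using ij by (intro sum.cong refl) (simp add: VU flip: sum_distrib_left)
    also have "\<dots> = X $$ (i, j)" using ij by simp
    finally show "F (F' X) $$ (i, j) = X $$ (i, j)" .
  qed (use X F in auto)
  have "bij_betw F (carrier ?A) (carrier ?M)"
  proof (rule bij_betw_byWitness[where f' = F'])
    show "\<forall>x\<in>carrier ?A. F' (F x) = x"
    proof
      fix x assume x: "x \<in> carrier ?A"
      show "F' (F x) = x"
      proof
        fix g show "F' (F x) g = x g"
          using F'F[of g x] x by (cases "g \<in> ?S") (auto simp: F'_def twisted_group_algebra_def)
      qed
    qed
  qed (use F FF' in \<open>auto simp: F'_def module_mat_def twisted_group_algebra_def\<close>)
  moreover have "F (x \<otimes>\<^bsub>?A\<^esub> y) = F x * F y" for x y
  proof (rule eq_matI)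
    fix i j assume "i < dim_row (F x * F y)" "j < dim_col (F x * F y)"
    then have ij: "i < n" "j < n" by (simp_all add: F_def)
    have "F (x \<otimes>\<^bsub>?A\<^esub> y) $$ (i, j) = (\<Sum>p\<in>?S. \<Sum>g\<in>?S. \<Sum>g'\<in>?S.
        if g \<otimes>\<^bsub>G\<^esub> g' = p then x g * y g' * (\<alpha> g g' * U p i j) else 0)"
      unfolding Fij[OF ij] twisted_group_algebra_def
      by (auto simp: sum_distrib_right intro!: sum.cong)
    also have "\<dots> = (\<Sum>g\<in>?S. \<Sum>g'\<in>?S. \<Sum>p\<in>?S.
        if g \<otimes>\<^bsub>G\<^esub> g' = p then x g * y g' * (\<alpha> g g' * U p i j) else 0)"
      by (rule trans[OF sum.swap sum.cong[OF refl sum.swap]])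
    also have "\<dots> = (\<Sum>g\<in>?S. \<Sum>g'\<in>?S. x g * y g' * (\<Sum>k<n. U g i k * U g' k j))"
      using fin ij by (intro sum.cong refl) (simp add: mult)
    also have "\<dots> = (\<Sum>g\<in>?S. \<Sum>g'\<in>?S. \<Sum>k<n. (x g * U g i k) * (y g' * U g' k j))"
      by (simp add: sum_distrib_left mult_ac)
    also have "\<dots> = (\<Sum>k<n. \<Sum>g\<in>?S. \<Sum>g'\<in>?S. (x g * U g i k) * (y g' * U g' k j))"
      by (rule trans[OF sum.cong[OF refl sum.swap] sum.swap])
    also have "\<dots> = (\<Sum>k<n. F x $$ (i, k) * F y $$ (k, j))"
      using ij by (simp add: Fij sum_product)
    also have "\<dots> = (F x * F y) $$ (i, j)"
      using F[of x] F[of y] ij by (simp add: scalar_prod_def atLeast0LessThan)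
    finally show "F (x \<otimes>\<^bsub>?A\<^esub> y) $$ (i, j) = (F x * F y) $$ (i, j)" .
  qed (simp_all add: F_def)
  moreover have "F \<one>\<^bsub>?A\<^esub> = 1\<^sub>m n"
  proof (rule eq_matI)
    fix i j assume ij: "i < dim_row (1\<^sub>m n :: complex mat)" "j < dim_col (1\<^sub>m n :: complex mat)"
    have "\<alpha> \<one>\<^bsub>G\<^esub> \<one>\<^bsub>G\<^esub> \<noteq> 0" using \<alpha> by (simp add: two_cocycle_def)
    moreover have "F \<one>\<^bsub>?A\<^esub> $$ (i, j) = (\<Sum>g\<in>?S. if g = \<one>\<^bsub>G\<^esub> then inverse (\<alpha> \<one>\<^bsub>G\<^esub> \<one>\<^bsub>G\<^esub>) * U \<one>\<^bsub>G\<^esub> i j else 0)"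
      using ij by (auto simp: Fij twisted_group_algebra_def intro!: sum.cong)
    ultimately show "F \<one>\<^bsub>?A\<^esub> $$ (i, j) = 1\<^sub>m n $$ (i, j)"
      using ij fin by (simp add: one)
  qed (simp_all add: F_def)
  moreover have "F (x \<oplus>\<^bsub>?A\<^esub> y) = F x + F y" for x y
    by (rule eq_matI) (simp_all add: F_def twisted_group_algebra_def sum.distrib ring_distribs)
  moreover have "F (c \<odot>\<^bsub>?A\<^esub> x) = c \<cdot>\<^sub>m F x" for c x
    by (rule eq_matI) (simp_all add: F_def twisted_group_algebra_def sum_distrib_left mult.assoc)
  ultimately have "F \<in> algebra_iso ?A ?M"
    using F by (simp add: algebra_iso_def ring_iso_def Ring.ring_hom_def module_mat_def)
  then show ?thesis by (simp add: F_def[abs_def])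
qed

section \<open>Semidirect products and the action on the dual group\<close>

definition semidirect_product :: "'d monoid \<Rightarrow> 'a monoid \<Rightarrow> ('a \<Rightarrow> 'd \<Rightarrow> 'd) \<Rightarrow> ('d \<times> 'a) monoid" where
  "semidirect_product D H act = \<lparr>carrier = carrier D \<times> carrier H,
     monoid.mult = (\<lambda>(x, a) (y, b). (x \<otimes>\<^bsub>D\<^esub> act a y, a \<otimes>\<^bsub>H\<^esub> b)), one = (\<one>\<^bsub>D\<^esub>, \<one>\<^bsub>H\<^esub>)\<rparr>"

lemma semidirect_product_simps [simp]:
  "carrier (semidirect_product D H act) = carrier D \<times> carrier H"
  "(x, a) \<otimes>\<^bsub>semidirect_product D H act\<^esub> (y, b) = (x \<otimes>\<^bsub>D\<^esub> act a y, a \<otimes>\<^bsub>H\<^esub> b)"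
  "\<one>\<^bsub>semidirect_product D H act\<^esub> = (\<one>\<^bsub>D\<^esub>, \<one>\<^bsub>H\<^esub>)"
  by (simp_all add: semidirect_product_def)

lemma hom_AutoGroupD:
  assumes H: "group H" and M: "group M" and act: "act \<in> hom H (AutoGroup M)"
  shows "\<lbrakk>g \<in> carrier H; x \<in> carrier M\<rbrakk> \<Longrightarrow> act g x \<in> carrier M"
    and "\<lbrakk>g \<in> carrier H; x \<in> carrier M; y \<in> carrier M\<rbrakk> \<Longrightarrow> act g (x \<otimes>\<^bsub>M\<^esub> y) = act g x \<otimes>\<^bsub>M\<^esub> act g y"
    and "\<lbrakk>g \<in> carrier H; h \<in> carrier H; x \<in> carrier M\<rbrakk> \<Longrightarrow> act (g \<otimes>\<^bsub>H\<^esub> h) x = act g (act h x)"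
    and "x \<in> carrier M \<Longrightarrow> act \<one>\<^bsub>H\<^esub> x = x"
    and "g \<in> carrier H \<Longrightarrow> act g \<one>\<^bsub>M\<^esub> = \<one>\<^bsub>M\<^esub>"
proof -
  have h: "act g \<in> hom M M" if "g \<in> carrier H" for g
    using act that by (auto simp: hom_AutoGroup_iff auto_def)
  show "g \<in> carrier H \<Longrightarrow> x \<in> carrier M \<Longrightarrow> act g x \<in> carrier M"
    and "g \<in> carrier H \<Longrightarrow> x \<in> carrier M \<Longrightarrow> y \<in> carrier M \<Longrightarrow> act g (x \<otimes>\<^bsub>M\<^esub> y) = act g x \<otimes>\<^bsub>M\<^esub> act g y"
    and "g \<in> carrier H \<Longrightarrow> act g \<one>\<^bsub>M\<^esub> = \<one>\<^bsub>M\<^esub>"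
    using h[of g] hom_one[OF h M M, of g] by (auto simp: hom_def)
  show "g \<in> carrier H \<Longrightarrow> h \<in> carrier H \<Longrightarrow> x \<in> carrier M \<Longrightarrow> act (g \<otimes>\<^bsub>H\<^esub> h) x = act g (act h x)"
    using act by (simp add: hom_AutoGroup_iff compose_def)
  have "act \<one>\<^bsub>H\<^esub> = \<one>\<^bsub>AutoGroup M\<^esub>" by (rule hom_one[OF act H group.AutoGroup[OF M]])
  then show "x \<in> carrier M \<Longrightarrow> act \<one>\<^bsub>H\<^esub> x = x" by (simp add: AutoGroup_def BijGroup_def)
qed

lemma group_semidirect_product:
  assumes D: "group D" and H: "group H" and act: "act \<in> hom H (AutoGroup D)"
  shows "group (semidirect_product D H act)"
proof -
  interpret D: group D by (rule D)
  interpret H: group H by (rule H)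
  note a = hom_AutoGroupD[OF H D act]
  show ?thesis
  proof (rule groupI)
    fix p assume "p \<in> carrier (semidirect_product D H act)"
    then obtain x b where p: "p = (x, b)" "x \<in> carrier D" "b \<in> carrier H" by auto
    show "\<exists>q\<in>carrier (semidirect_product D H act).
        q \<otimes>\<^bsub>semidirect_product D H act\<^esub> p = \<one>\<^bsub>semidirect_product D H act\<^esub>"
      \<comment> \<open>A left inverse of \<open>(x, b)\<close>: the inverse of \<open>x\<close>,
        moved by the inverse of \<open>b\<close>.\<close>
      by (rule bexI[of _ "(act (inv\<^bsub>H\<^esub> b) (inv\<^bsub>D\<^esub> x), inv\<^bsub>H\<^esub> b)"])
        (use p in \<open>simp_all add: a flip: a(2)\<close>)
  qed (auto simp: a D.m_assoc H.m_assoc)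
qed

text \<open>The contragredient action: precomposition reverses products, and the inverse of
  \<open>a\<close> restores a left action. The inner restriction keeps the result in the dual, the
  outer one makes the map extensional.\<close>

definition dual_action ::
    "'a monoid \<Rightarrow> 'm monoid \<Rightarrow> ('a \<Rightarrow> 'm \<Rightarrow> 'm) \<Rightarrow> 'a \<Rightarrow> ('m \<Rightarrow> complex) \<Rightarrow> 'm \<Rightarrow> complex" where
  "dual_action H M act a =
     (\<lambda>\<chi>\<in>carrier (dual_group M). \<lambda>m\<in>carrier M. \<chi> (act (inv\<^bsub>H\<^esub> a) m))"

lemma dual_action_hom:
  assumes H: "group H" and M: "group M" and act: "act \<in> hom H (AutoGroup M)"
  shows "dual_action H M act \<in> hom H (AutoGroup (dual_group M))"
proof -
  interpret H: group H by (rule H)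
  interpret D: comm_group "dual_group M" using M by (rule group.comm_group_dual)
  note a = hom_AutoGroupD[OF H M act]
  let ?D = "dual_group M"
  have cl: "dual_action H M act g \<chi> \<in> carrier ?D" if "g \<in> carrier H" "\<chi> \<in> carrier ?D" for g \<chi>
    using that group.is_monoid[OF M, THEN monoid.m_closed] by (auto simp: dual_action_def character_def a)
  show ?thesis
  proof (rule hom_AutoGroupI[OF H])
    fix g assume g: "g \<in> carrier H"
    show "dual_action H M act g \<in> hom ?D ?D"
    proof (rule homI)
      fix \<chi> \<xi> assume \<chi>: "\<chi> \<in> carrier ?D" and \<xi>: "\<xi> \<in> carrier ?D"
      have "\<chi> \<otimes>\<^bsub>?D\<^esub> \<xi> \<in> carrier ?D" using \<chi> \<xi> by (rule D.m_closed)
      then show "dual_action H M act g (\<chi> \<otimes>\<^bsub>?D\<^esub> \<xi>) = dual_action H M act g \<chi> \<otimes>\<^bsub>?D\<^esub> dual_action H M act g \<xi>"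
        using \<chi> \<xi> g unfolding dual_action_def by (auto simp: a simp del: dual_group_simps(1) intro!: ext)
    qed (rule cl[OF g])
    show "dual_action H M act g \<in> extensional (carrier ?D)" by (simp add: dual_action_def del: dual_group_simps)
  next
    fix g h \<chi> assume "g \<in> carrier H" "h \<in> carrier H" "\<chi> \<in> carrier ?D"
    then show "dual_action H M act (g \<otimes>\<^bsub>H\<^esub> h) \<chi> = dual_action H M act g (dual_action H M act h \<chi>)"
      using cl[of h \<chi>] unfolding dual_action_def
      by (auto simp: a H.inv_mult_group simp del: dual_group_simps(1) intro!: ext)
  next
    fix \<chi> assume "\<chi> \<in> carrier ?D"
    then show "dual_action H M act \<one>\<^bsub>H\<^esub> \<chi> = \<chi>"
      by (auto simp: dual_action_def a fun_eq_iff extensional_def)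
  qed
qed

section \<open>The twisted group algebra built from a bijective cocycle\<close>

lemma quotient_morphism_of_bijective_cocycle:
  fixes H :: "'a monoid" and M :: "'m monoid"
  assumes H: "group H" and finH: "finite (carrier H)" and h: "bij_betw h {..<n} (carrier H)"
    and bc: "bijective_cocycle H M act \<delta>"
  obtains G :: "(('m \<Rightarrow> complex) \<times> 'a) monoid" and \<alpha> \<psi> \<phi> where
    "group G" "finite (carrier G)" "two_cocycle G \<alpha>"
    "quotient_morphism (twisted_grading G \<alpha>) (elementary_crossed_product H n h) \<psi> \<phi>"
proof -
  interpret H: group H by (rule H)
  have M: "comm_group M" and act: "act \<in> hom H (AutoGroup M)" and \<delta>: "bij_betw \<delta> (carrier H) (carrier M)"
    and coc: "\<And>a b. a \<in> carrier H \<Longrightarrow> b \<in> carrier H \<Longrightarrow> \<delta> (a \<otimes>\<^bsub>H\<^esub> b) = \<delta> a \<otimes>\<^bsub>M\<^esub> act a (\<delta> b)"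
    using bc unfolding bijective_cocycle_def by blast+
  interpret M: comm_group M by (rule M)
  let ?D = "dual_group M"
  interpret D: comm_group ?D by (rule M.comm_group_dual)
  note a = hom_AutoGroupD[OF H M.is_group act]
  have \<delta>c: "\<delta> b \<in> carrier M" if "b \<in> carrier H" for b using \<delta> that by (auto simp: bij_betw_def)
  have finM: "finite (carrier M)" using \<delta> finH bij_betw_finite by blast
  have hc: "h i \<in> carrier H" if "i < n" for i using h that by (auto simp: bij_betw_def)
  have hinj: "h i = h j \<longleftrightarrow> i = j" if "i < n" "j < n" for i j
    using h that by (auto simp: bij_betw_def inj_on_def)
  define \<kappa> where "\<kappa> = inv_into {..<n} h"
  have \<kappa>: "\<kappa> b < n" "h (\<kappa> b) = b" if "b \<in> carrier H" for b
    using h that inv_into_into[of b h "{..<n}"] by (auto simp: \<kappa>_def bij_betw_def f_inv_into_f)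
  have sum_h: "(\<Sum>i<n. if h i = b then f i else 0) = f (\<kappa> b)" if b: "b \<in> carrier H"
    for b and f :: "nat \<Rightarrow> complex"
  proof -
    have "(\<Sum>i<n. if h i = b then f i else 0) = (\<Sum>i<n. if i = \<kappa> b then f i else 0)"
      using \<kappa>[OF b] by (intro sum.cong) (auto simp: hinj)
    then show ?thesis using \<kappa>[OF b] by simp
  qed
  have n: "order M = n"
    using bij_betw_same_card[OF h] bij_betw_same_card[OF \<delta>] by (simp add: order_def)
  have n0: "n \<noteq> 0" using \<kappa>(1)[OF H.one_closed] by simp
  define G where "G = semidirect_product ?D H (dual_action H M act)"
  have da: "dual_action H M act \<in> hom H (AutoGroup ?D)" by (rule dual_action_hom[OF H M.is_group act])
  have G: "group G"
    unfolding G_def by (rule group_semidirect_product[OF D.is_group H da])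
  have Gc: "carrier G = carrier ?D \<times> carrier H" by (simp add: G_def)
  have finG: "finite (carrier G)" unfolding Gc using M.finite_dual_group[OF finM] finH by blast
  \<comment> \<open>The cocycle identity seen through a character. It drives both the cocycle law of
    \<open>\<alpha>\<close> and the multiplication rule of the matrices \<open>U\<close>.\<close>
  have \<chi>\<delta>: "\<chi> (\<delta> (inv\<^bsub>H\<^esub> b \<otimes>\<^bsub>H\<^esub> c)) = \<chi> (\<delta> (inv\<^bsub>H\<^esub> b)) * dual_action H M act b \<chi> (\<delta> c)"
    if "\<chi> \<in> carrier ?D" "b \<in> carrier H" "c \<in> carrier H" for \<chi> b c
    using that by (simp add: coc dual_action_def a \<delta>c character_mult)
  \<comment> \<open>Moving the diagonal factor of \<open>q\<close> past the translation of
    \<open>p\<close> shifts its argument by the inverse of \<open>snd p\<close>; by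
    \<open>\<chi>\<delta>\<close> this costs exactly this scalar.\<close>
  define \<alpha> where "\<alpha> p q = fst q (\<delta> (inv\<^bsub>H\<^esub> (snd p)))" for p q :: "('m \<Rightarrow> complex) \<times> 'a"
  have \<alpha>: "two_cocycle G \<alpha>"
    unfolding two_cocycle_def
  proof (intro conjI ballI)
    show "\<alpha> p q \<noteq> 0" if "p \<in> carrier G" "q \<in> carrier G" for p q
      using that by (auto simp: Gc \<alpha>_def character_def \<delta>c)
  next
    fix p q r assume pqr: "p \<in> carrier G" "q \<in> carrier G" "r \<in> carrier G"
    obtain \<chi> b \<xi> c \<eta> d where p: "p = (\<chi>, b)" and q: "q = (\<xi>, c)" and r: "r = (\<eta>, d)"
      using prod.exhaust by metis
    have b: "b \<in> carrier H" and c: "c \<in> carrier H" and \<eta>: "\<eta> \<in> carrier ?D"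
      using pqr by (auto simp: p q r Gc)
    have "\<eta> (\<delta> (inv\<^bsub>H\<^esub> (b \<otimes>\<^bsub>H\<^esub> c))) = \<eta> (\<delta> (inv\<^bsub>H\<^esub> c)) * dual_action H M act c \<eta> (\<delta> (inv\<^bsub>H\<^esub> b))"
      using \<chi>\<delta>[OF \<eta> c, of "inv\<^bsub>H\<^esub> b"] b c by (simp add: H.inv_mult_group)
    then show "\<alpha> p q * \<alpha> (p \<otimes>\<^bsub>G\<^esub> q) r = \<alpha> q r * \<alpha> p (q \<otimes>\<^bsub>G\<^esub> r)"
      using b \<delta>c by (simp add: p q r G_def \<alpha>_def)
  qed
  define U where "U p i j = (if h i = snd p \<otimes>\<^bsub>H\<^esub> h j then fst p (\<delta> (h i)) else 0)"
    for p :: "('m \<Rightarrow> complex) \<times> 'a" and i j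
  \<comment> \<open>The dual basis: same support, inverted entries, divided by \<open>n\<close>
    because the orthogonality sums equal \<open>order M\<close>.\<close>
  define V where "V p i j = (if h i = snd p \<otimes>\<^bsub>H\<^esub> h j then inverse (fst p (\<delta> (h i))) / of_nat n else 0)"
    for p :: "('m \<Rightarrow> complex) \<times> 'a" and i j
  define \<psi> where "\<psi> x = mat n n (\<lambda>(i, j). \<Sum>p\<in>carrier G. x p * U p i j)" for x
  have sum_\<chi>: "(\<Sum>i<n. f (\<delta> (h i))) = (\<Sum>m\<in>carrier M. f m)" for f :: "'m \<Rightarrow> complex"
    using sum.reindex_bij_betw[OF bij_betw_trans[OF h \<delta>], of f] by simp
  have "\<psi> \<in> algebra_iso (twisted_group_algebra G \<alpha>) (matrix_algebra n)"
    unfolding \<psi>_def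
  proof (rule twisted_algebra_iso_matrixI[OF G finG \<alpha>, where V = V])
    fix i j assume "i < n" "j < n"
    then show "U \<one>\<^bsub>G\<^esub> i j = (if i = j then \<alpha> \<one>\<^bsub>G\<^esub> \<one>\<^bsub>G\<^esub> else 0)"
      by (simp add: U_def \<alpha>_def G_def hc hinj \<delta>c)
  next
    fix p q i j assume pq: "p \<in> carrier G" "q \<in> carrier G" and ij: "i < n" "j < n"
    obtain \<chi> b \<xi> c where p: "p = (\<chi>, b)" and q: "q = (\<xi>, c)" using prod.exhaust by metis
    have b: "b \<in> carrier H" and c: "c \<in> carrier H" and \<xi>: "\<xi> \<in> carrier ?D"
      using pq by (auto simp: p q Gc)
    \<comment> \<open>Only the \<open>k\<close> with \<open>h k = c \<otimes> h j\<close>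
      contributes. Where \<open>U p i k\<close> is nonzero, that element is the inverse of
      \<open>b\<close> times \<open>h i\<close>, the argument to which \<open>\<chi>\<delta>\<close>
      applies.\<close>
    have "(\<Sum>k<n. U p i k * U q k j) = (\<Sum>k<n. if h k = c \<otimes>\<^bsub>H\<^esub> h j then U p i k * \<xi> (\<delta> (h k)) else 0)"
      by (intro sum.cong refl) (simp add: q U_def)
    also have "\<dots> = U p i (\<kappa> (c \<otimes>\<^bsub>H\<^esub> h j)) * \<xi> (\<delta> (c \<otimes>\<^bsub>H\<^esub> h j))"
      using c hc[OF ij(2)] by (simp add: sum_h \<kappa>)
    also have "\<dots> = (if h i = b \<otimes>\<^bsub>H\<^esub> c \<otimes>\<^bsub>H\<^esub> h j then \<chi> (\<delta> (h i)) * \<xi> (\<delta> (inv\<^bsub>H\<^esub> b \<otimes>\<^bsub>H\<^esub> h i)) else 0)"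
      using b c hc[OF ij(1)] hc[OF ij(2)] by (auto simp: U_def p \<kappa> H.m_assoc simp flip: H.m_assoc[of "inv\<^bsub>H\<^esub> b"])
    also have "\<dots> = \<alpha> p q * U (p \<otimes>\<^bsub>G\<^esub> q) i j"
    proof -
      have Upq: "U (p \<otimes>\<^bsub>G\<^esub> q) i j =
          (if h i = b \<otimes>\<^bsub>H\<^esub> c \<otimes>\<^bsub>H\<^esub> h j then \<chi> (\<delta> (h i)) * dual_action H M act b \<xi> (\<delta> (h i)) else 0)"
        using \<delta>c[OF hc[OF ij(1)]] by (simp only: U_def p q G_def semidirect_product_simps dual_group_simps prod.sel restrict_apply' if_True)
      show ?thesis unfolding Upq \<chi>\<delta>[OF \<xi> b hc[OF ij(1)]] by (simp add: \<alpha>_def p q)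
    qed
    finally show "(\<Sum>k<n. U p i k * U q k j) = \<alpha> p q * U (p \<otimes>\<^bsub>G\<^esub> q) i j" .
  next
    fix p q assume pq: "p \<in> carrier G" "q \<in> carrier G"
    obtain \<chi> b \<xi> c where p: "p = (\<chi>, b)" and q: "q = (\<xi>, c)" using prod.exhaust by metis
    have b: "b \<in> carrier H" and c: "c \<in> carrier H" and \<xi>: "\<xi> \<in> carrier ?D" and \<chi>: "\<chi> \<in> carrier ?D"
      using pq by (auto simp: p q Gc)
    \<comment> \<open>In row \<open>i\<close> the two supports share one column if
      \<open>b = c\<close> and none otherwise. The remaining sum over \<open>i\<close> becomes a sum
      over \<open>M\<close> through the bijections \<open>h\<close> and
      \<open>\<delta>\<close>.\<close>
    have "(\<Sum>j<n. U p i j * V q i j) = (if b = c then \<chi> (\<delta> (h i)) * inverse (\<xi> (\<delta> (h i))) / of_nat n else 0)"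
      if i: "i < n" for i
    proof -
      have "(\<Sum>j<n. U p i j * V q i j) = (\<Sum>j<n. if h j = inv\<^bsub>H\<^esub> b \<otimes>\<^bsub>H\<^esub> h i then
          (if b = c then \<chi> (\<delta> (h i)) * inverse (\<xi> (\<delta> (h i))) / of_nat n else 0) else 0)"
      proof (intro sum.cong refl)
        fix j assume "j \<in> {..<n}"
        then have j: "h j \<in> carrier H" using hc by simp
        have "h i = b \<otimes>\<^bsub>H\<^esub> h j \<longleftrightarrow> h j = inv\<^bsub>H\<^esub> b \<otimes>\<^bsub>H\<^esub> h i"
          using b j hc[OF i] H.inv_solve_left by metis
        moreover have "b \<otimes>\<^bsub>H\<^esub> h j = c \<otimes>\<^bsub>H\<^esub> h j \<longleftrightarrow> b = c" using b c j by simp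
        ultimately show "U p i j * V q i j = (if h j = inv\<^bsub>H\<^esub> b \<otimes>\<^bsub>H\<^esub> h i then
            (if b = c then \<chi> (\<delta> (h i)) * inverse (\<xi> (\<delta> (h i))) / of_nat n else 0) else 0)"
          by (auto simp: U_def V_def p q)
      qed
      then show ?thesis using b hc[OF i] by (simp add: sum_h)
    qed
    then have "(\<Sum>i<n. \<Sum>j<n. U p i j * V q i j) =
        (if b = c then (\<Sum>i<n. \<chi> (\<delta> (h i)) * inverse (\<xi> (\<delta> (h i)))) / of_nat n else 0)"
      by (simp add: sum_divide_distrib)
    also have "\<dots> = (if p = q then 1 else 0)"
      using sum_\<chi>[of "\<lambda>m. \<chi> m * inverse (\<xi> m)"] M.character_orthogonality[OF \<chi> \<xi>] n n0
      by (auto simp: p q)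
    finally show "(\<Sum>i<n. \<Sum>j<n. U p i j * V q i j) = (if p = q then 1 else 0)" .
  next
    fix i j i' j' assume ij: "i < n" "j < n" and ij': "i' < n" "j' < n"
    have hc4: "h i \<in> carrier H" "h j \<in> carrier H" "h i' \<in> carrier H" "h j' \<in> carrier H"
      using hc ij ij' by auto
    \<comment> \<open>The position \<open>(i, j)\<close> determines the component in
      \<open>H\<close>, so only a sum over characters remains. It compares
      \<open>\<delta> (h i)\<close> with \<open>\<delta> (h i')\<close>, and injectivity of
      \<open>\<delta>\<close> forces \<open>i = i'\<close>.\<close>
    let ?b = "h i \<otimes>\<^bsub>H\<^esub> inv\<^bsub>H\<^esub> (h j)"
    have inner: "(\<Sum>b\<in>carrier H. U (\<chi>, b) i j * V (\<chi>, b) i' j') =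
        (if h i' = ?b \<otimes>\<^bsub>H\<^esub> h j' then \<chi> (\<delta> (h i)) * inverse (\<chi> (\<delta> (h i'))) / of_nat n else 0)" for \<chi>
    proof -
      have "(\<Sum>b\<in>carrier H. U (\<chi>, b) i j * V (\<chi>, b) i' j') = (\<Sum>b\<in>carrier H. if b = ?b then
        (if h i' = ?b \<otimes>\<^bsub>H\<^esub> h j' then \<chi> (\<delta> (h i)) * inverse (\<chi> (\<delta> (h i'))) / of_nat n else 0) else 0)"
      proof (intro sum.cong refl)
        fix b assume b: "b \<in> carrier H"
        have "h i = b \<otimes>\<^bsub>H\<^esub> h j \<longleftrightarrow> b = ?b" using b hc4 H.inv_solve_right by metis
        then show "U (\<chi>, b) i j * V (\<chi>, b) i' j' = (if b = ?b then
          (if h i' = ?b \<otimes>\<^bsub>H\<^esub> h j' then \<chi> (\<delta> (h i)) * inverse (\<chi> (\<delta> (h i'))) / of_nat n else 0) else 0)"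
          by (auto simp: U_def V_def)
      qed
      then show ?thesis using finH hc4 by simp
    qed
    have "(\<Sum>p\<in>carrier G. U p i j * V p i' j') =
        (\<Sum>\<chi>\<in>carrier ?D. \<Sum>b\<in>carrier H. U (\<chi>, b) i j * V (\<chi>, b) i' j')"
      by (simp add: Gc sum.cartesian_product' del: dual_group_simps)
    also have "\<dots> = (if h i' = ?b \<otimes>\<^bsub>H\<^esub> h j'
        then (\<Sum>\<chi>\<in>carrier ?D. \<chi> (\<delta> (h i)) * inverse (\<chi> (\<delta> (h i')))) / of_nat n else 0)"
      by (simp add: inner sum_divide_distrib del: dual_group_simps)
    also have "\<dots> = (if h i' = ?b \<otimes>\<^bsub>H\<^esub> h j' \<and> \<delta> (h i) = \<delta> (h i') then 1 else 0)"
      using n0 hc4 by (simp add: M.dual_orthogonality[OF finM] \<delta>c n del: dual_group_simps)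
    also have "\<delta> (h i) = \<delta> (h i') \<longleftrightarrow> i = i'"
      using \<delta> hc4 hinj ij ij' by (auto simp: bij_betw_def inj_on_def)
    also have "h i' = ?b \<otimes>\<^bsub>H\<^esub> h j' \<and> i = i' \<longleftrightarrow> i = i' \<and> j = j'"
    proof -
      have bj: "?b \<otimes>\<^bsub>H\<^esub> h j = h i" using hc4 by (simp add: H.m_assoc)
      have "?b \<otimes>\<^bsub>H\<^esub> h j = ?b \<otimes>\<^bsub>H\<^esub> h j' \<longleftrightarrow> h j = h j'"
        using hc4 by (intro H.Units_l_cancel) auto
      then show ?thesis unfolding bj using hinj ij ij' by auto
    qed
    finally show "(\<Sum>p\<in>carrier G. U p i j * V p i' j') = (if i = i' \<and> j = j' then 1 else 0)" .
  qed
  moreover have "snd \<in> epi G H"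
    using D.one_closed by (auto simp: epi_def hom_def G_def simp del: dual_group_simps intro!: image_eqI)
  moreover have "\<psi> ` cmp (twisted_grading G \<alpha>) p \<subseteq> cmp (elementary_crossed_product H n h) (snd p)"
    if p: "p \<in> carrier G" for p
  proof
    fix X assume "X \<in> \<psi> ` cmp (twisted_grading G \<alpha>) p"
    then obtain x where x: "X = \<psi> x" "\<And>k. k \<noteq> p \<Longrightarrow> x k = 0" by (auto simp: twisted_grading_def)
    have "h i \<otimes>\<^bsub>H\<^esub> inv\<^bsub>H\<^esub> (h j) = snd p" if ij: "i < n" "j < n" and nz: "X $$ (i, j) \<noteq> 0" for i j
    proof -
      have "X $$ (i, j) = (\<Sum>k\<in>carrier G. x k * U k i j)" using ij by (simp add: x(1) \<psi>_def)
      also have "\<dots> = (\<Sum>k\<in>carrier G. if k = p then x p * U p i j else 0)"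
        by (intro sum.cong) (auto simp: x(2))
      finally have "U p i j \<noteq> 0" using nz finG p by auto
      then have "h i = snd p \<otimes>\<^bsub>H\<^esub> h j" by (auto simp: U_def split: if_splits)
      then show ?thesis using hc ij p by (auto simp: Gc H.m_assoc)
    qed
    then show "X \<in> cmp (elementary_crossed_product H n h) (snd p)"
      by (auto simp: elementary_crossed_product_def x(1) \<psi>_def)
  qed
  ultimately have "quotient_morphism (twisted_grading G \<alpha>) (elementary_crossed_product H n h) \<psi> snd"
    by (simp add: quotient_morphism_def twisted_grading_def elementary_crossed_product_def)
  then show thesis using that[OF G finG \<alpha>] by blast
qed

section \<open>Passing from representatives to classes of gradings\<close>

theorem theoremF:
  fixes H :: "'a monoid" and n :: nat and h :: "nat \<Rightarrow> 'a"
  assumes "group H" and "finite (carrier H)" and "order H = n"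
    and "bij_betw h {..<n} (carrier H)"
  shows "IYB H \<longleftrightarrow>
    (\<exists>C \<in> twisted_group_algebra_classes n.
       is_quotient_class (grading_class (elementary_crossed_product H n h)) C)"
proof
  let ?E = "elementary_crossed_product H n h"
  have E: "graded_algebra ?E"
    using assms by (intro graded_algebra_elementary) (auto simp: bij_betw_def)
  show "\<exists>C\<in>twisted_group_algebra_classes n. is_quotient_class (grading_class ?E) C" if IYB: "IYB H"
  proof -
    obtain M :: "nat monoid" and act \<delta> where "bijective_cocycle H M act \<delta>"
      using IYB by (auto simp: IYB_def)
    then obtain G :: "((nat \<Rightarrow> complex) \<times> 'a) monoid" and \<alpha> \<psi> \<phi> where
      G: "group G" "finite (carrier G)" "two_cocycle G \<alpha>"
      and q: "quotient_morphism (twisted_grading G \<alpha>) ?E \<psi> \<phi>"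
      using quotient_morphism_of_bijective_cocycle[OF assms(1,2,4)] by metis
    \<comment> \<open>The constructed group consists of pairs, whereas the classes are formed over
      groups of natural numbers; the equivalence is then reversed so that the composite starts at
      \<open>G'\<close>.\<close>
    obtain G' :: "nat monoid" and \<alpha>' where
      G': "group G'" "finite (carrier G')" "two_cocycle G' \<alpha>'"
      and eq: "graded_equivalent (twisted_grading G \<alpha>) (twisted_grading G' \<alpha>')"
      using twisted_grading_on_nat[OF G] by metis
    have T: "graded_algebra (twisted_grading G' \<alpha>')" by (rule graded_algebra_twisted[OF G'])
    obtain \<psi>' \<phi>' where "quotient_morphism (twisted_grading G' \<alpha>') (twisted_grading G \<alpha>) \<psi>' \<phi>'"
      using graded_equivalent_sym[OF graded_algebra_twisted[OF G] T eq] by (auto simp: graded_equivalent_def)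
    then have q': "quotient_morphism (twisted_grading G' \<alpha>') ?E (\<psi> \<circ> \<psi>') (\<phi> \<circ> \<phi>')"
      using q by (rule quotient_morphism_trans)
    then have "\<psi> \<circ> \<psi>' \<in> algebra_iso (twisted_group_algebra G' \<alpha>') (matrix_algebra n)"
      by (simp add: quotient_morphism_def twisted_grading_def elementary_crossed_product_def)
    then have "grading_class (twisted_grading G' \<alpha>') \<in> twisted_group_algebra_classes n"
      using G' unfolding twisted_group_algebra_classes_def by blast
    moreover have "is_quotient_class (grading_class ?E) (grading_class (twisted_grading G' \<alpha>'))"
      using is_quotient_class_iff[OF T E] q' by blast
    ultimately show ?thesis by blast
  qed
  show "IYB H" if ex: "\<exists>C\<in>twisted_group_algebra_classes n. is_quotient_class (grading_class ?E) C"
  proof -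
    obtain G :: "nat monoid" and \<alpha> where G: "group G" "finite (carrier G)" "two_cocycle G \<alpha>"
      and "is_quotient_class (grading_class ?E) (grading_class (twisted_grading G \<alpha>))"
      using ex by (auto simp: twisted_group_algebra_classes_def)
    then obtain \<psi> \<phi> where "quotient_morphism (twisted_grading G \<alpha>) ?E \<psi> \<phi>"
      using is_quotient_class_iff[OF graded_algebra_twisted[OF G] E] by blast
    then show ?thesis by (rule IYB_of_quotient_morphism[OF G assms(1,2,4)])
  qed
qed

end
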